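(* Let $M$ be a surface of genus $\geq 2$ equipped with a hyperbolic metric $\sigma$ of total area $A$. Then for every $D>0$ there exists a Riemannian metric $g$ on $M$ of total area $A$ that is conformally equivalent to $\sigma$ and such that $\mathrm{diam}(M,g)>D$.
   Context: $M$ is a smooth closed surface and metrics are smooth. A hyperbolic metric is a Riemannian metric of constant Gaussian curvature $-1$. $g$ is conformally equivalent to $\sigma$ if $g=e^{2u}\sigma$ for a smooth function $u\colon M\to\mathbb{R}$. $\mathrm{diam}(M,g)$ is the diameter of $M$ for the distance induced by $g$. *)

theory Defs
  imports "HOL-Analysis.Analysis"
begin

section \<open>Smooth maps on open subsets of Euclidean space\<close>

text \<open>
  Both notions are meant for open \<open>S\<close> only: derivatives are taken with respect to full
  neighbourhoods, so the values of \<open>f\<close> outside \<open>S\<close> are irrelevant.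
\<close>

primrec Ck_on ::
  "nat \<Rightarrow> ('a::euclidean_space \<Rightarrow> 'b::real_normed_vector) \<Rightarrow> 'a set \<Rightarrow> bool" where
  "Ck_on 0 f S \<longleftrightarrow> continuous_on S f"
| "Ck_on (Suc k) f S \<longleftrightarrow>
     (\<forall>x\<in>S. f differentiable (at x)) \<and>
     (\<forall>v. Ck_on k (\<lambda>x. frechet_derivative f (at x) v) S)"

definition smooth_on ::
  "('a::euclidean_space \<Rightarrow> 'b::real_normed_vector) \<Rightarrow> 'a set \<Rightarrow> bool" where
  "smooth_on f S \<longleftrightarrow> (\<forall>k. Ck_on k f S)"


section \<open>Closed smooth surfaces\<close>

text \<open>
  A surface is a topology \<open>X\<close> together with a smooth atlas \<open>\<A>\<close>, not necessarily a maximal one.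
  A chart is a pair of a domain and a coordinate map; the values of the coordinate map
  outside the domain are irrelevant.
\<close>

type_synonym 'a chart = "'a set \<times> ('a \<Rightarrow> real^2)"

abbreviation dom_of :: "'a chart \<Rightarrow> 'a set" where
  "dom_of \<equiv> fst"

abbreviation coord :: "'a chart \<Rightarrow> 'a \<Rightarrow> real^2" where
  "coord \<equiv> snd"

definition ran_of :: "'a chart \<Rightarrow> (real^2) set" where
  "ran_of c = coord c ` dom_of c"

definition inv_coord :: "'a chart \<Rightarrow> real^2 \<Rightarrow> 'a" where
  "inv_coord c = inv_into (dom_of c) (coord c)"

definition transition :: "'a chart \<Rightarrow> 'a chart \<Rightarrow> real^2 \<Rightarrow> real^2" where
  "transition c d = coord d \<circ> inv_coord c"

definition is_chart :: "'a topology \<Rightarrow> 'a chart \<Rightarrow> bool" where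
  "is_chart X c \<longleftrightarrow>
     openin X (dom_of c) \<and> open (ran_of c) \<and>
     homeomorphic_map (subtopology X (dom_of c)) (top_of_set (ran_of c)) (coord c)"

definition smooth_atlas :: "'a topology \<Rightarrow> 'a chart set \<Rightarrow> bool" where
  "smooth_atlas X \<A> \<longleftrightarrow>
     (\<forall>c\<in>\<A>. is_chart X c) \<and>
     (\<Union>c\<in>\<A>. dom_of c) = topspace X \<and>
     (\<forall>c\<in>\<A>. \<forall>d\<in>\<A>. smooth_on (transition c d) (coord c ` (dom_of c \<inter> dom_of d)))"

definition closed_smooth_surface :: "'a topology \<Rightarrow> 'a chart set \<Rightarrow> bool" where
  "closed_smooth_surface X \<A> \<longleftrightarrow>
     Hausdorff_space X \<and> second_countable X \<and> compact_space X \<and> connected_space X \<and>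
     smooth_atlas X \<A>"

definition smooth_function :: "'a chart set \<Rightarrow> ('a \<Rightarrow> real) \<Rightarrow> bool" where
  "smooth_function \<A> u \<longleftrightarrow> (\<forall>c\<in>\<A>. smooth_on (u \<circ> inv_coord c) (ran_of c))"

text \<open>
  The genus in the sense of Riemann: the largest number of pairwise disjoint simple closed
  curves whose union does not disconnect the surface.
\<close>

definition simple_closed_curve_in :: "'a topology \<Rightarrow> 'a set \<Rightarrow> bool" where
  "simple_closed_curve_in X C \<longleftrightarrow>
     C \<subseteq> topspace X \<and>
     subtopology X C homeomorphic_space top_of_set (sphere (0::real^2) 1)"

definition genus :: "'a topology \<Rightarrow> enat" where
  "genus X = Sup {enat (card \<C>) | \<C>.
     finite \<C> \<and> pairwise disjnt \<C> \<and> (\<forall>C\<in>\<C>. simple_closed_curve_in X C) \<and>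
     connected_space (subtopology X (topspace X - \<Union>\<C>))}"


section \<open>Riemannian metrics\<close>

text \<open>
  A metric is given by its Gram matrices in the charts of the atlas: \<open>g c x\<close> is the matrix
  \<open>(g\<^sub>i\<^sub>j)\<close> in the chart \<open>c\<close> at the point with coordinates \<open>x \<in> ran_of c\<close>.  The Gram matrices in
  two charts are related by the transformation law of a covariant 2-tensor.  The values of \<open>g\<close>
  for \<open>c \<notin> \<A>\<close> or \<open>x \<notin> ran_of c\<close> are irrelevant.
\<close>

type_synonym 'a metric_field = "'a chart \<Rightarrow> real^2 \<Rightarrow> real^2^2"

definition riemannian_metric :: "'a chart set \<Rightarrow> 'a metric_field \<Rightarrow> bool" where
  "riemannian_metric \<A> g \<longleftrightarrow>
     (\<forall>c\<in>\<A>. smooth_on (g c) (ran_of c) \<and>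
        (\<forall>x\<in>ran_of c. transpose (g c x) = g c x \<and> (\<forall>v. v \<noteq> 0 \<longrightarrow> v \<bullet> (g c x *v v) > 0))) \<and>
     (\<forall>c\<in>\<A>. \<forall>d\<in>\<A>. \<forall>p \<in> dom_of c \<inter> dom_of d.
        let J = matrix (frechet_derivative (transition c d) (at (coord c p)))
        in g c (coord c p) = transpose J ** g d (coord d p) ** J)"

definition conformally_equivalent ::
  "'a chart set \<Rightarrow> 'a metric_field \<Rightarrow> 'a metric_field \<Rightarrow> bool" where
  "conformally_equivalent \<A> g \<sigma> \<longleftrightarrow>
     (\<exists>u. smooth_function \<A> u \<and>
        (\<forall>c\<in>\<A>. \<forall>x\<in>ran_of c. g c x = exp (2 * u (inv_coord c x)) *\<^sub>R \<sigma> c x))"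


section \<open>Gaussian curvature\<close>

definition partial :: "2 \<Rightarrow> (real^2 \<Rightarrow> real) \<Rightarrow> real^2 \<Rightarrow> real" where
  "partial k f x = frechet_derivative f (at x) (axis k 1)"

text \<open>\<open>christoffel G k i j\<close> is \<open>\<Gamma>\<^sup>k\<^sub>i\<^sub>j\<close> for the metric with Gram matrix \<open>G\<close>.\<close>

definition christoffel :: "(real^2 \<Rightarrow> real^2^2) \<Rightarrow> 2 \<Rightarrow> 2 \<Rightarrow> 2 \<Rightarrow> real^2 \<Rightarrow> real" where
  "christoffel G k i j x =
     (\<Sum>l\<in>UNIV. matrix_inv (G x) $ k $ l *
        (partial i (\<lambda>y. G y $ j $ l) x + partial j (\<lambda>y. G y $ i $ l) x
          - partial l (\<lambda>y. G y $ i $ j) x)) / 2"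

text \<open>
  \<open>riemann_tensor G l i j k\<close> is the component along \<open>\<partial>\<^sub>l\<close> of \<open>R(\<partial>\<^sub>i, \<partial>\<^sub>j)\<partial>\<^sub>k\<close>, where
  \<open>R(X, Y)Z = \<nabla>\<^sub>X\<nabla>\<^sub>Y Z - \<nabla>\<^sub>Y\<nabla>\<^sub>X Z - \<nabla>\<^bsub>[X,Y]\<^esub> Z\<close>.
\<close>

definition riemann_tensor :: "(real^2 \<Rightarrow> real^2^2) \<Rightarrow> 2 \<Rightarrow> 2 \<Rightarrow> 2 \<Rightarrow> 2 \<Rightarrow> real^2 \<Rightarrow> real" where
  "riemann_tensor G l i j k x =
     partial i (christoffel G l j k) x - partial j (christoffel G l i k) x
     + (\<Sum>m\<in>UNIV. christoffel G m j k x * christoffel G l i m x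
                  - christoffel G m i k x * christoffel G l j m x)"

text \<open>\<open>K = \<langle>R(\<partial>\<^sub>1, \<partial>\<^sub>2)\<partial>\<^sub>2, \<partial>\<^sub>1\<rangle> / det G\<close>.\<close>

definition gaussian_curvature :: "(real^2 \<Rightarrow> real^2^2) \<Rightarrow> real^2 \<Rightarrow> real" where
  "gaussian_curvature G x = (\<Sum>l\<in>UNIV. riemann_tensor G l 1 2 2 x * G x $ l $ 1) / det (G x)"

definition hyperbolic_metric :: "'a chart set \<Rightarrow> 'a metric_field \<Rightarrow> bool" where
  "hyperbolic_metric \<A> \<sigma> \<longleftrightarrow>
     riemannian_metric \<A> \<sigma> \<and> (\<forall>c\<in>\<A>. \<forall>x\<in>ran_of c. gaussian_curvature (\<sigma> c) x = -1)"


section \<open>Area\<close>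

text \<open>
  A finite list of charts whose domains \<open>U\<^sub>0, U\<^sub>1, \<dots>\<close> cover the surface decomposes it into the
  disjoint Borel pieces \<open>U\<^sub>i - \<Union>\<^sub>j\<^sub><\<^sub>i U\<^sub>j\<close>, on each of which the area element \<open>sqrt (det g\<^sub>i\<^sub>j) dx dy\<close>
  is integrated in the \<open>i\<close>-th chart.  Such a cover exists by compactness, and by the change of
  variables formula the total does not depend on the choice of the cover.
\<close>

definition finite_chart_cover :: "'a topology \<Rightarrow> 'a chart set \<Rightarrow> 'a chart list \<Rightarrow> bool" where
  "finite_chart_cover X \<A> cs \<longleftrightarrow>
     set cs \<subseteq> \<A> \<and> (\<Union>c\<in>set cs. dom_of c) = topspace X"

definition area_via :: "'a metric_field \<Rightarrow> 'a chart list \<Rightarrow> ennreal" where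
  "area_via g cs =
     (\<Sum>i<length cs.
        \<integral>\<^sup>+x \<in> coord (cs ! i) ` (dom_of (cs ! i) - (\<Union>j<i. dom_of (cs ! j))).
          ennreal (sqrt (det (g (cs ! i) x))) \<partial>lborel)"

definition total_area :: "'a topology \<Rightarrow> 'a chart set \<Rightarrow> 'a metric_field \<Rightarrow> ennreal" where
  "total_area X \<A> g = area_via g (SOME cs. finite_chart_cover X \<A> cs)"


section \<open>Length, distance and diameter\<close>

text \<open>
  Curves are piecewise \<open>C\<^sup>1\<close> in the usual sense: one-sided derivatives exist at the break points.
\<close>

definition C1_curve_on :: "'a chart set \<Rightarrow> (real \<Rightarrow> 'a) \<Rightarrow> real \<Rightarrow> real \<Rightarrow> bool" where
  "C1_curve_on \<A> \<gamma> a b \<longleftrightarrow>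
     (\<forall>c\<in>\<A>. \<exists>D. continuous_on {t\<in>{a..b}. \<gamma> t \<in> dom_of c} D \<and>
        (\<forall>t\<in>{a..b}. \<gamma> t \<in> dom_of c \<longrightarrow>
           ((coord c \<circ> \<gamma>) has_vector_derivative D t) (at t within {a..b})))"

definition piecewise_C1_curve :: "'a topology \<Rightarrow> 'a chart set \<Rightarrow> (real \<Rightarrow> 'a) \<Rightarrow> bool" where
  "piecewise_C1_curve X \<A> \<gamma> \<longleftrightarrow>
     pathin X \<gamma> \<and>
     (\<exists>n s. s 0 = 0 \<and> s n = 1 \<and>
        (\<forall>i<n. s i < s (Suc i) \<and> C1_curve_on \<A> \<gamma> (s i) (s (Suc i))))"

text \<open>
  The norm of \<open>\<gamma>'(t)\<close> may be computed in any chart around \<open>\<gamma> t\<close>.  At the finitely many break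
  points its value is arbitrary.
\<close>

definition chart_at :: "'a chart set \<Rightarrow> 'a \<Rightarrow> 'a chart" where
  "chart_at \<A> p = (SOME c. c \<in> \<A> \<and> p \<in> dom_of c)"

definition speed :: "'a chart set \<Rightarrow> 'a metric_field \<Rightarrow> (real \<Rightarrow> 'a) \<Rightarrow> real \<Rightarrow> real" where
  "speed \<A> g \<gamma> t =
     (let c = chart_at \<A> (\<gamma> t); v = vector_derivative (coord c \<circ> \<gamma>) (at t)
      in sqrt (v \<bullet> (g c (coord c (\<gamma> t)) *v v)))"

definition curve_length :: "'a chart set \<Rightarrow> 'a metric_field \<Rightarrow> (real \<Rightarrow> 'a) \<Rightarrow> ennreal" where
  "curve_length \<A> g \<gamma> = (\<integral>\<^sup>+t\<in>{0..1}. ennreal (speed \<A> g \<gamma> t) \<partial>lborel)"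

definition riemannian_dist ::
  "'a topology \<Rightarrow> 'a chart set \<Rightarrow> 'a metric_field \<Rightarrow> 'a \<Rightarrow> 'a \<Rightarrow> ennreal" where
  "riemannian_dist X \<A> g p q =
     Inf {curve_length \<A> g \<gamma> | \<gamma>. piecewise_C1_curve X \<A> \<gamma> \<and> \<gamma> 0 = p \<and> \<gamma> 1 = q}"

definition riemannian_diam :: "'a topology \<Rightarrow> 'a chart set \<Rightarrow> 'a metric_field \<Rightarrow> ennreal" where
  "riemannian_diam X \<A> g = (SUP p\<in>topspace X. SUP q\<in>topspace X. riemannian_dist X \<A> g p q)"

end

theory Submission
  imports Defs "HOL-Computational_Algebra.Polynomial"
begin

text \<open>
  Blow up a small coordinate disc by a conformal factor.  With \<open>g = (k + f) \<sigma>\<close> and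
  \<open>f x = b \<chi>(x) / (\<bar>x - x0\<bar>\<^sup>2 + \<epsilon>\<^sup>2)\<close>, where \<open>\<chi>\<close> is a cutoff, both the area \<open>\<integral> f d\<sigma>\<close> and
  the length of a radius grow like \<open>log (1 / \<epsilon>)\<close> when \<open>b = 1\<close>.  Area scales like \<open>b\<close> and
  length like \<open>sqrt b\<close>, so taking \<open>b\<close> of order \<open>1 / log (1 / \<epsilon>)\<close> keeps the added area below
  \<open>A / 2\<close>, to be compensated by \<open>k \<ge> 1 / 2\<close>, while the length from \<open>x0\<close> to the boundary
  of the disc is of order \<open>sqrt (log (1 / \<epsilon>))\<close>.
\<close>

section \<open>Calculus of smooth maps\<close>

text \<open>The factor 1 / r^2 turns a punctured disc into a cylinder: in polar coordinates |dx|^2 /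
  r^2 = (d log r)^2 + (d theta)^2, of fixed circumference and, cut off at radius \<epsilon>, of
  length about log (1 / \<epsilon>). Scaling by a small b makes this a long thin spike of controlled
  area, because in dimension two area is linear in the factor multiplying the metric while length
  only sees its square root. The same linearity settles the requirement that the area be exactly A:
  the integral of the bump is bounded but never evaluated, and k is solved for afterwards from k A +
  (added area) = A. The diameter bound has to hold for every curve, including those that leave the
  chart and return. A curve is therefore followed only up to its first exit from the concentric disc
  of half the radius, on which the cutoff stays away from 0.\<close>

lemma frechet_derivative_eqI:
  assumes "open S" "x \<in> S" "\<And>y. y \<in> S \<Longrightarrow> f y = g y"
  shows "frechet_derivative f (at x) = frechet_derivative g (at x)"
proof -
  have "(f has_derivative D) (at x) \<longleftrightarrow> (g has_derivative D) (at x)" for D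
    using assms by (metis has_derivative_transform_within_open)
  then show ?thesis by (simp add: frechet_derivative_def)
qed

lemma Ck_on_cong:
  assumes "open S" "\<And>x. x \<in> S \<Longrightarrow> f x = g x"
  shows "Ck_on k f S \<longleftrightarrow> Ck_on k g S"
  using assms
proof (induction k arbitrary: f g)
  case 0
  then show ?case by (simp cong: continuous_on_cong)
next
  case (Suc k)
  have "f differentiable (at x) \<longleftrightarrow> g differentiable (at x)" if "x \<in> S" for x
    unfolding differentiable_def
    using Suc.prems that by (metis has_derivative_transform_within_open)
  moreover have "Ck_on k (\<lambda>x. frechet_derivative f (at x) v) S
      \<longleftrightarrow> Ck_on k (\<lambda>x. frechet_derivative g (at x) v) S" for v
    using Suc.prems by (intro Suc.IH) (auto simp: frechet_derivative_eqI[of S _ f g])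
  ultimately show ?case by simp
qed

lemma Ck_on_subset: "Ck_on k f S \<Longrightarrow> T \<subseteq> S \<Longrightarrow> Ck_on k f T"
  by (induction k arbitrary: f) (auto intro: continuous_on_subset)

lemma Ck_on_imp_continuous: "Ck_on k f S \<Longrightarrow> continuous_on S f"
  by (cases k) (auto intro!: continuous_at_imp_continuous_on differentiable_imp_continuous_within)

lemma Ck_on_SucD: "Ck_on (Suc k) f S \<Longrightarrow> Ck_on k f S"
proof (induction k arbitrary: f)
  case 0
  then show ?case by (metis Ck_on_imp_continuous Ck_on.simps(1))
next
  case (Suc k)
  then show ?case by (metis Ck_on.simps(2))
qed

text \<open>\<open>Ck_on\<close> refers to \<open>frechet_derivative\<close>, which is a choice.
  Uniqueness of the derivative allows any explicit formula \<open>f'\<close> to replace it, and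
  openness of \<open>S\<close> transfers the replacement to all higher derivatives.\<close>

lemma Ck_on_SucI:
  assumes "open S" "\<And>x. x \<in> S \<Longrightarrow> (f has_derivative f' x) (at x)"
    and "\<And>v. Ck_on k (\<lambda>x. f' x v) S"
  shows "Ck_on (Suc k) f S"
proof -
  have "frechet_derivative f (at x) = f' x" if "x \<in> S" for x
    using assms(2)[OF that] by (rule frechet_derivative_at[symmetric])
  then have "Ck_on k (\<lambda>x. frechet_derivative f (at x) v) S" for v
    using assms(3)[of v] by (subst Ck_on_cong[OF assms(1), of _ "\<lambda>x. f' x v"]) auto
  with assms(2) show ?thesis by (auto simp: differentiable_def)
qed

lemma Ck_on_Suc_has_derivative:
  "Ck_on (Suc k) f S \<Longrightarrow> x \<in> S \<Longrightarrow> (f has_derivative frechet_derivative f (at x)) (at x)"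
  by (simp add: frechet_derivative_works)

lemma Ck_on_const: "open S \<Longrightarrow> Ck_on k (\<lambda>x. c) S"
  by (induction k arbitrary: c) (auto intro: Ck_on_SucI[where f' = "\<lambda>_ _. 0"])

lemma Ck_on_add:
  assumes "open S" "Ck_on k f S" "Ck_on k g S"
  shows "Ck_on k (\<lambda>x. f x + g x) S"
  using assms
proof (induction k arbitrary: f g)
  case 0
  then show ?case by (simp add: continuous_on_add)
next
  case (Suc k)
  show ?case
    by (rule Ck_on_SucI[OF Suc.prems(1)], rule has_derivative_add)
      (use Suc in \<open>auto intro: Ck_on_Suc_has_derivative\<close>)
qed

lemma Ck_on_sum:
  assumes "open S" "finite I" "\<And>i. i \<in> I \<Longrightarrow> Ck_on k (f i) S"
  shows "Ck_on k (\<lambda>x. \<Sum>i\<in>I. f i x) S"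
  using assms(2,3) by (induction I) (auto intro: Ck_on_const Ck_on_add assms(1))

lemma Ck_on_linear:
  assumes "open S" "bounded_linear h" "Ck_on k f S"
  shows "Ck_on k (\<lambda>x. h (f x)) S"
  using assms
proof (induction k arbitrary: f)
  case 0
  then show ?case by (simp add: bounded_linear.continuous_on)
next
  case (Suc k)
  show ?case
    by (rule Ck_on_SucI[OF Suc.prems(1)], rule bounded_linear.has_derivative[OF Suc.prems(2)])
      (use Suc in \<open>auto intro: Ck_on_Suc_has_derivative\<close>)
qed

text \<open>Both terms of the product rule are again \<open>h\<close> applied to maps of class one
  lower, so the induction closes. Treating all bilinear maps at once covers real products, scalar
  multiples and inner products.\<close>

lemma Ck_on_bilinear:
  assumes "open S" "bounded_bilinear h" "Ck_on k f S" "Ck_on k g S"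
  shows "Ck_on k (\<lambda>x. h (f x) (g x)) S"
  using assms
proof (induction k arbitrary: f g)
  case 0
  then show ?case by (simp add: bounded_bilinear.continuous_on)
next
  case (Suc k)
  show ?case
  proof (rule Ck_on_SucI[OF Suc.prems(1)])
    show "((\<lambda>x. h (f x) (g x)) has_derivative
        (\<lambda>v. h (f x) (frechet_derivative g (at x) v) + h (frechet_derivative f (at x) v) (g x))) (at x)"
      if "x \<in> S" for x
      by (intro bounded_bilinear.FDERIV[OF Suc.prems(2)] Ck_on_Suc_has_derivative[OF Suc.prems(3) that]
          Ck_on_Suc_has_derivative[OF Suc.prems(4) that])
    show "Ck_on k (\<lambda>x. h (f x) (frechet_derivative g (at x) v)
        + h (frechet_derivative f (at x) v) (g x)) S" for v
      using Suc.prems(3,4)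
      by (intro Ck_on_add Suc.IH Suc.prems Ck_on_SucD[OF Suc.prems(3)] Ck_on_SucD[OF Suc.prems(4)]) simp_all
  qed
qed

lemma Ck_on_compose:
  fixes g :: "'a::euclidean_space \<Rightarrow> 'b::euclidean_space"
  assumes "open S" "Ck_on k f T" "Ck_on k g S" "g ` S \<subseteq> T"
  shows "Ck_on k (f \<circ> g) S"
  using assms
proof (induction k arbitrary: f)
  case 0
  then show ?case by (metis Ck_on.simps(1) continuous_on_compose continuous_on_subset)
next
  case (Suc k)
  define f' g' where "f' = (\<lambda>y. frechet_derivative f (at y))"
    and "g' = (\<lambda>x. frechet_derivative g (at x))"
  have f': "(f has_derivative f' (g x)) (at (g x))" if "x \<in> S" for x
    unfolding f'_def using that Suc.prems(4) by (intro Ck_on_Suc_has_derivative[OF Suc.prems(2)]) blast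
  have g': "(g has_derivative g' x) (at x)" if "x \<in> S" for x
    unfolding g'_def by (rule Ck_on_Suc_has_derivative[OF Suc.prems(3) that])
  \<comment> \<open>The chain rule differentiates \<open>f\<close> in the direction
    \<open>g' x v\<close>, which moves with \<open>x\<close>, whereas \<open>Ck_on\<close> controls
    derivatives in fixed directions only. Expanding in the basis separates the moving coefficients
    from the fixed directions.\<close>
  have lin: "f' (g x) (g' x v) = (\<Sum>b\<in>Basis. (g' x v \<bullet> b) *\<^sub>R f' (g x) b)" if "x \<in> S" for x v
  proof -
    have "f' (g x) (\<Sum>b\<in>Basis. (g' x v \<bullet> b) *\<^sub>R b) = (\<Sum>b\<in>Basis. (g' x v \<bullet> b) *\<^sub>R f' (g x) b)"
      using has_derivative_linear[OF f'[OF that]] by (simp add: linear_sum linear_cmul)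
    then show ?thesis by (simp add: euclidean_representation)
  qed
  show ?case
  proof (rule Ck_on_SucI[OF Suc.prems(1)])
    show "(f \<circ> g has_derivative f' (g x) \<circ> g' x) (at x)" if "x \<in> S" for x
      using g'[OF that] f'[OF that] by (rule diff_chain_at)
    fix v
    have "Ck_on k (\<lambda>x. f' (g x) b) S" for b
    proof -
      have "Ck_on k ((\<lambda>y. f' y b) \<circ> g) S"
        using Suc.prems(2) by (intro Suc.IH Suc.prems Ck_on_SucD[OF Suc.prems(3)]) (simp add: f'_def)
      then show ?thesis by (simp add: o_def)
    qed
    moreover have "Ck_on k (\<lambda>x. g' x v \<bullet> b) S" for b
      using Suc.prems(3) by (intro Ck_on_linear[OF Suc.prems(1) bounded_linear_inner_left]) (simp add: g'_def)
    ultimately have "Ck_on k (\<lambda>x. \<Sum>b\<in>Basis. (g' x v \<bullet> b) *\<^sub>R f' (g x) b) S"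
      by (intro Ck_on_sum[OF Suc.prems(1) finite_Basis]
          Ck_on_bilinear[OF Suc.prems(1) bounded_bilinear_scaleR])
    then show "Ck_on k (\<lambda>x. (f' (g x) \<circ> g' x) v) S"
      by (subst Ck_on_cong[OF Suc.prems(1)]) (simp_all only: lin o_def)
  qed
qed

lemma Ck_on_Un:
  assumes "open S" "open T" "Ck_on k f S" "Ck_on k f T"
  shows "Ck_on k f (S \<union> T)"
  using assms(3,4) by (induction k arbitrary: f) (auto intro: continuous_on_open_Un assms(1,2))

lemma Ck_on_real_SucI:
  fixes f :: "real \<Rightarrow> real"
  assumes "open S" "\<And>x. x \<in> S \<Longrightarrow> (f has_real_derivative f' x) (at x)" "Ck_on k f' S"
  shows "Ck_on (Suc k) f S"
  using Ck_on_linear[OF assms(1) bounded_linear_mult_left assms(3)]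
  by (intro Ck_on_SucI[OF assms(1) assms(2)[unfolded has_field_derivative_def]])

lemma smooth_on_cong:
  "open S \<Longrightarrow> (\<And>x. x \<in> S \<Longrightarrow> f x = g x) \<Longrightarrow> smooth_on f S \<longleftrightarrow> smooth_on g S"
  unfolding smooth_on_def using Ck_on_cong by blast

lemma smooth_on_subset: "smooth_on f S \<Longrightarrow> T \<subseteq> S \<Longrightarrow> smooth_on f T"
  unfolding smooth_on_def using Ck_on_subset by blast

lemma smooth_on_imp_continuous: "smooth_on f S \<Longrightarrow> continuous_on S f"
  unfolding smooth_on_def using Ck_on_imp_continuous by blast

lemma smooth_on_has_derivative:
  "smooth_on f S \<Longrightarrow> x \<in> S \<Longrightarrow> (f has_derivative frechet_derivative f (at x)) (at x)"
  unfolding smooth_on_def using Ck_on_Suc_has_derivative by blast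

lemma smooth_on_const: "open S \<Longrightarrow> smooth_on (\<lambda>x. c) S"
  unfolding smooth_on_def by (simp add: Ck_on_const)

lemma smooth_on_ident: "open S \<Longrightarrow> smooth_on (\<lambda>x. x) S"
  unfolding smooth_on_def
proof
  fix k
  assume "open S"
  then show "Ck_on k (\<lambda>x. x) S"
    by (cases k) (auto intro: Ck_on_SucI[where f' = "\<lambda>_ v. v"] Ck_on_const simp del: Ck_on.simps(2))
qed

lemma smooth_on_add:
  "open S \<Longrightarrow> smooth_on f S \<Longrightarrow> smooth_on g S \<Longrightarrow> smooth_on (\<lambda>x. f x + g x) S"
  unfolding smooth_on_def by (simp add: Ck_on_add)

lemma smooth_on_bilinear:
  "open S \<Longrightarrow> bounded_bilinear h \<Longrightarrow> smooth_on f S \<Longrightarrow> smooth_on g S \<Longrightarrow>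
    smooth_on (\<lambda>x. h (f x) (g x)) S"
  unfolding smooth_on_def using Ck_on_bilinear by blast

lemma smooth_on_compose:
  fixes g :: "'a::euclidean_space \<Rightarrow> 'b::euclidean_space"
  shows "open S \<Longrightarrow> smooth_on f T \<Longrightarrow> smooth_on g S \<Longrightarrow> g ` S \<subseteq> T \<Longrightarrow>
    smooth_on (\<lambda>x. f (g x)) S"
  unfolding smooth_on_def using Ck_on_compose[unfolded o_def] by blast

lemma smooth_on_Un:
  "open S \<Longrightarrow> open T \<Longrightarrow> smooth_on f S \<Longrightarrow> smooth_on f T \<Longrightarrow> smooth_on f (S \<union> T)"
  unfolding smooth_on_def by (simp add: Ck_on_Un)

section \<open>Smoothness of elementary real functions\<close>

lemma smooth_on_exp: "smooth_on (exp :: real \<Rightarrow> real) UNIV"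
proof -
  have "Ck_on k (exp :: real \<Rightarrow> real) UNIV" for k
  proof (induction k)
    case (Suc k)
    show ?case
      by (rule Ck_on_real_SucI[OF open_UNIV _ Suc]) (rule DERIV_exp)
  qed (simp add: continuous_on_exp)
  then show ?thesis by (simp add: smooth_on_def)
qed

lemma smooth_on_inverse: "smooth_on (inverse :: real \<Rightarrow> real) {0<..}"
proof -
  have "Ck_on k (inverse :: real \<Rightarrow> real) {0<..}" for k
  proof (induction k)
    case 0
    then show ?case by (auto intro: continuous_intros)
  next
    case (Suc k)
    show ?case
    proof (rule Ck_on_real_SucI[OF open_greaterThan])
      show "(inverse has_real_derivative - (inverse x * inverse x)) (at x)" if "x \<in> {0<..}" for x :: real
        using that by (auto intro!: derivative_eq_intros)
      show "Ck_on k (\<lambda>x::real. - (inverse x * inverse x)) {0<..}"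
        by (intro Ck_on_linear[OF open_greaterThan bounded_linear_minus[OF bounded_linear_ident]]
            Ck_on_bilinear[OF open_greaterThan bounded_bilinear_mult] Suc)
    qed
  qed
  then show ?thesis by (simp add: smooth_on_def)
qed

lemma smooth_on_ln: "smooth_on (ln :: real \<Rightarrow> real) {0<..}"
  unfolding smooth_on_def
proof
  fix k
  show "Ck_on k (ln :: real \<Rightarrow> real) {0<..}"
  proof (cases k)
    case (Suc j)
    show ?thesis unfolding Suc
      by (rule Ck_on_real_SucI[where f' = inverse])
        (use smooth_on_inverse in \<open>auto simp: smooth_on_def intro: DERIV_ln\<close>)
  qed (auto intro!: continuous_on_ln)
qed

section \<open>A flat function\<close>

text \<open>The polynomial factor makes the family closed under differentiation. The cutoff itself
  is built from \<open>flat 1\<close>, that is exp (-1 / t) for positive t.\<close>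

definition flat :: "real poly \<Rightarrow> real \<Rightarrow> real" where
  "flat p t = (if t > 0 then poly p (1 / t) * exp (- 1 / t) else 0)"

lemma flat_tendsto_0:
  fixes p :: "real poly"
  shows "((\<lambda>t. poly p (1 / t) * exp (- 1 / t)) \<longlongrightarrow> 0) (at_right 0)"
proof -
  have "((\<lambda>y. poly p y * exp (- y)) \<longlongrightarrow> 0) at_top"
  proof -
    have "((\<lambda>y. \<Sum>i\<le>degree p. coeff p i * (y ^ i / exp y)) \<longlongrightarrow> (\<Sum>i\<le>degree p. coeff p i * 0)) at_top"
      by (rule tendsto_sum, rule tendsto_mult[OF tendsto_const], rule tendsto_power_div_exp_0)
    then show ?thesis
      by (simp add: poly_altdef sum_divide_distrib exp_minus divide_simps)
  qed
  from filterlim_compose[OF this filterlim_inverse_at_top_right]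
  show ?thesis by (simp add: inverse_eq_divide)
qed

text \<open>With s = 1 / t one has d/dt = - s^2 d/ds, which sends p(s) exp (-s) to s^2 (p - p')(s)
  exp (-s); the coefficient list \<open>[:0, 0, 1:]\<close> is s^2.\<close>

lemma flat_has_derivative:
  "(flat p has_real_derivative flat ([:0, 0, 1:] * (p - pderiv p)) t) (at t)"
proof -
  let ?q = "[:0, 0, 1:] * (p - pderiv p)"
  consider "t > 0" | "t < 0" | "t = 0" by linarith
  then show ?thesis
  proof cases
    case 1
    have "((\<lambda>t. poly p (1 / t) * exp (- 1 / t)) has_real_derivative flat ?q t) (at t)"
      using 1 by (auto intro!: derivative_eq_intros simp: flat_def field_simps power2_eq_square)
    then show ?thesis
      by (rule has_field_derivative_transform_within_open[where S = "{0<..}"])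
        (use 1 in \<open>auto simp: flat_def\<close>)
  next
    case 2
    have "((\<lambda>t. 0) has_real_derivative flat ?q t) (at t)"
      using 2 by (simp add: flat_def)
    then show ?thesis
      by (rule has_field_derivative_transform_within_open[where S = "{..<0}"])
        (use 2 in \<open>auto simp: flat_def\<close>)
  next
    case 3
    have "((\<lambda>h. (flat p (0 + h) - flat p 0) / h) \<longlongrightarrow> 0) (at 0)"
    proof (rule filterlim_split_at)
      show "((\<lambda>h. (flat p (0 + h) - flat p 0) / h) \<longlongrightarrow> 0) (at_left 0)"
        by (rule tendsto_eventually) (auto simp: flat_def eventually_at_filter)
      \<comment> \<open>Dividing by h multiplies the polynomial by its variable 1 / h, which is what
        \<open>pCons 0\<close> does, so the quotient is covered by the same limit.\<close>
      have "\<forall>\<^sub>F h in at_right 0. poly (pCons 0 p) (1 / h) * exp (- 1 / h) = (flat p (0 + h) - flat p 0) / h"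
        by (auto simp: flat_def eventually_at_filter)
      with flat_tendsto_0[of "pCons 0 p"]
      show "((\<lambda>h. (flat p (0 + h) - flat p 0) / h) \<longlongrightarrow> 0) (at_right 0)"
        by (rule Lim_transform_eventually)
    qed
    then show ?thesis using 3 by (simp add: DERIV_def flat_def)
  qed
qed

lemma smooth_on_flat: "smooth_on (flat p) UNIV"
proof -
  have "Ck_on k (flat p) UNIV" for k
  proof (induction k arbitrary: p)
    case 0
    show ?case
      by (auto simp: continuous_on_eq_continuous_at intro: DERIV_isCont[OF flat_has_derivative])
  next
    case (Suc k)
    show ?case
      by (rule Ck_on_real_SucI[OF open_UNIV flat_has_derivative Suc])
  qed
  then show ?thesis by (simp add: smooth_on_def)
qed

section \<open>Charts and conformal metrics\<close>

lemma chart_facts: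
  assumes "is_chart X c"
  shows chart_openin: "openin X (dom_of c)"
    and chart_open: "open (ran_of c)"
    and chart_inj: "inj_on (coord c) (dom_of c)"
    and chart_dom_subset: "dom_of c \<subseteq> topspace X"
    and chart_topspace: "topspace (subtopology X (dom_of c)) = dom_of c"
    and chart_homeomorphic: "homeomorphic_map (subtopology X (dom_of c)) (top_of_set (ran_of c)) (coord c)"
proof -
  show *: "openin X (dom_of c)" "open (ran_of c)"
    "homeomorphic_map (subtopology X (dom_of c)) (top_of_set (ran_of c)) (coord c)"
    using assms by (auto simp: is_chart_def)
  show "dom_of c \<subseteq> topspace X"
    using *(1) by (rule openin_subset)
  then show "topspace (subtopology X (dom_of c)) = dom_of c"
    by auto
  then show "inj_on (coord c) (dom_of c)"
    using homeomorphic_imp_injective_map[OF *(3)] by simp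
qed

lemma coord_in_ran: "p \<in> dom_of c \<Longrightarrow> coord c p \<in> ran_of c"
  by (simp add: ran_of_def)

lemma inv_coord_in_dom: "x \<in> ran_of c \<Longrightarrow> inv_coord c x \<in> dom_of c"
  unfolding ran_of_def inv_coord_def by (rule inv_into_into)

lemma coord_inv_coord: "x \<in> ran_of c \<Longrightarrow> coord c (inv_coord c x) = x"
  unfolding ran_of_def inv_coord_def by (rule f_inv_into_f)

lemma inv_coord_coord: "is_chart X c \<Longrightarrow> p \<in> dom_of c \<Longrightarrow> inv_coord c (coord c p) = p"
  unfolding inv_coord_def by (intro inv_into_f_f chart_inj)

lemma coord_image_iff:
  "is_chart X c \<Longrightarrow> x \<in> ran_of c \<Longrightarrow> x \<in> coord c ` (dom_of c \<inter> U) \<longleftrightarrow> inv_coord c x \<in> U"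
  by (auto simp: inv_coord_coord inv_coord_in_dom coord_inv_coord intro!: image_eqI[where x = "inv_coord c x"])

lemma open_coord_image:
  assumes "is_chart X c" "openin X U"
  shows "open (coord c ` (dom_of c \<inter> U))"
proof -
  have "openin (subtopology X (dom_of c)) (dom_of c \<inter> U)"
    using assms(2) by (simp add: openin_subtopology_Int2)
  then have "openin (top_of_set (ran_of c)) (coord c ` (dom_of c \<inter> U))"
    using homeomorphic_imp_open_map[OF chart_homeomorphic[OF assms(1)]] by (simp add: open_map_def)
  then show ?thesis
    using chart_open[OF assms(1)] by (simp add: openin_open_eq)
qed

lemma continuous_map_inv_coord:
  assumes "is_chart X c"
  shows "continuous_map (top_of_set (ran_of c)) X (inv_coord c)"
  unfolding continuous_map
proof (intro conjI allI impI)
  show "inv_coord c ` topspace (top_of_set (ran_of c)) \<subseteq> topspace X"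
    using chart_dom_subset[OF assms] by (auto dest: inv_coord_in_dom)
next
  fix U
  assume U: "openin X U"
  have "{x \<in> ran_of c. inv_coord c x \<in> U} = coord c ` (dom_of c \<inter> U)"
    using coord_image_iff[OF assms, of _ U] by (auto simp: ran_of_def)
  then show "openin (top_of_set (ran_of c)) {x \<in> topspace (top_of_set (ran_of c)). inv_coord c x \<in> U}"
    using open_coord_image[OF assms U] by (auto simp: openin_open_eq[OF chart_open[OF assms]])
qed

text \<open>Compactness in a Hausdorff space gives closedness in all of \<open>X\<close>, not just
  in the chart domain. This makes the complement of the support open, so that a function can be
  continued by a constant.\<close>

lemma closedin_inv_coord_image:
  assumes "is_chart X c" "Hausdorff_space X" "compact K" "K \<subseteq> ran_of c"
  shows "closedin X (inv_coord c ` K)"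
proof -
  have "compactin (top_of_set (ran_of c)) K"
    using assms(3,4) by (simp add: compactin_subtopology)
  then have "compactin X (inv_coord c ` K)"
    by (rule image_compactin[OF _ continuous_map_inv_coord[OF assms(1)]])
  then show ?thesis
    by (rule compactin_imp_closedin[OF assms(2)])
qed

lemma openin_inv_coord_image:
  assumes "is_chart X c" "open V" "V \<subseteq> ran_of c"
  shows "openin X (inv_coord c ` V)"
proof -
  have "inv_coord c ` V = {p \<in> dom_of c. coord c p \<in> V}"
    using assms(3) by (force simp: inv_coord_coord[OF assms(1)] coord_inv_coord inv_coord_in_dom)
  moreover have "openin (subtopology X (dom_of c)) {p \<in> dom_of c. coord c p \<in> V}"
    using homeomorphic_imp_continuous_map[OF chart_homeomorphic[OF assms(1)]] assms(2,3)
    unfolding continuous_map chart_topspace[OF assms(1)] openin_open_eq[OF chart_open[OF assms(1)]]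
    by blast
  ultimately show ?thesis
    using chart_openin[OF assms(1)] openin_trans_full by metis
qed

lemma smooth_atlasD:
  assumes "smooth_atlas X \<A>"
  shows atlas_chart: "c \<in> \<A> \<Longrightarrow> is_chart X c"
    and atlas_cover: "(\<Union>c\<in>\<A>. dom_of c) = topspace X"
    and atlas_transition: "c \<in> \<A> \<Longrightarrow> d \<in> \<A> \<Longrightarrow>
      smooth_on (transition c d) (coord c ` (dom_of c \<inter> dom_of d))"
  using assms by (auto simp: smooth_atlas_def)

section \<open>Extension from a chart to the surface, and conformal change\<close>

definition extend_by :: "'a chart \<Rightarrow> (real^2 \<Rightarrow> real) \<Rightarrow> real \<Rightarrow> 'a \<Rightarrow> real" where
  "extend_by c f k p = (if p \<in> dom_of c then f (coord c p) else k)"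

text \<open>The range of any chart \<open>d\<close> is covered by two open sets: the overlap with
  \<open>c\<close>, where the function is \<open>f\<close> after a transition map, and the part
  lying off the compact image of \<open>K\<close>, where it is constant.\<close>

lemma smooth_function_extend_by:
  assumes atlas: "smooth_atlas X \<A>" and "Hausdorff_space X" and c: "c \<in> \<A>"
    and K: "compact K" "K \<subseteq> ran_of c"
    and f: "smooth_on f (ran_of c)" "\<And>x. x \<in> ran_of c - K \<Longrightarrow> f x = k"
  shows "smooth_function \<A> (extend_by c f k)"
  unfolding smooth_function_def
proof
  fix d
  assume d: "d \<in> \<A>"
  note chart_c = atlas_chart[OF atlas c] and chart_d = atlas_chart[OF atlas d]
  let ?U = "coord d ` (dom_of d \<inter> dom_of c)"
  let ?V = "coord d ` (dom_of d \<inter> (topspace X - inv_coord c ` K))"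
  have U: "open ?U"
    by (rule open_coord_image[OF chart_d chart_openin[OF chart_c]])
  have V: "open ?V"
    by (rule open_coord_image[OF chart_d openin_diff[OF openin_topspace
        closedin_inv_coord_image[OF chart_c assms(2) K]]])
  have sub: "?U \<subseteq> ran_of d" "?V \<subseteq> ran_of d"
    by (auto simp: ran_of_def)
  have cover: "ran_of d = ?U \<union> ?V"
  proof
    show "ran_of d \<subseteq> ?U \<union> ?V"
    proof
      fix x
      assume x: "x \<in> ran_of d"
      show "x \<in> ?U \<union> ?V"
        unfolding Un_iff coord_image_iff[OF chart_d x]
        using chart_dom_subset[OF chart_d] inv_coord_in_dom[OF x] inv_coord_in_dom[of _ c] K(2)
        by (auto dest: subsetD)
    qed
  qed (use sub in blast)
  have "smooth_on (extend_by c f k \<circ> inv_coord d) ?U"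
  proof (subst smooth_on_cong[OF U, of _ "\<lambda>x. f (transition d c x)"])
    show "(extend_by c f k \<circ> inv_coord d) x = f (transition d c x)" if "x \<in> ?U" for x
      using that by (auto simp: extend_by_def transition_def inv_coord_coord[OF chart_d])
    show "smooth_on (\<lambda>x. f (transition d c x)) ?U"
      by (rule smooth_on_compose[OF U f(1) atlas_transition[OF atlas d c]])
        (auto simp: transition_def inv_coord_coord[OF chart_d] coord_in_ran)
  qed
  moreover have "smooth_on (extend_by c f k \<circ> inv_coord d) ?V"
  proof (subst smooth_on_cong[OF V, of _ "\<lambda>x. k"])
    show "(extend_by c f k \<circ> inv_coord d) x = k" if "x \<in> ?V" for x
    proof -
      from that obtain p where p: "p \<in> dom_of d" "p \<notin> inv_coord c ` K" "x = coord d p"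
        by auto
      have "f (coord c p) = k" if "p \<in> dom_of c"
      proof (rule f(2))
        show "coord c p \<in> ran_of c - K"
          using p(2) that inv_coord_coord[OF chart_c that] by (metis DiffI coord_in_ran image_eqI)
      qed
      then show ?thesis
        using p by (simp add: extend_by_def inv_coord_coord[OF chart_d])
    qed
  qed (rule smooth_on_const[OF V])
  ultimately show "smooth_on (extend_by c f k \<circ> inv_coord d) (ran_of d)"
    unfolding cover by (intro smooth_on_Un U V)
qed

lemma riemannian_metricD:
  assumes "riemannian_metric \<A> g" "c \<in> \<A>"
  shows metric_smooth: "smooth_on (g c) (ran_of c)"
    and metric_pos: "x \<in> ran_of c \<Longrightarrow> v \<noteq> 0 \<Longrightarrow> v \<bullet> (g c x *v v) > 0"
  using assms by (auto simp: riemannian_metric_def)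

definition conformal_metric :: "('a \<Rightarrow> real) \<Rightarrow> 'a metric_field \<Rightarrow> 'a metric_field" where
  "conformal_metric u g c x = exp (2 * u (inv_coord c x)) *\<^sub>R g c x"

lemma conformally_equivalent_conformal_metric:
  "smooth_function \<A> u \<Longrightarrow> conformally_equivalent \<A> (conformal_metric u g) g"
  by (auto simp: conformally_equivalent_def conformal_metric_def)

text \<open>The factor depends on the point and not on the chart, so it is the same scalar on both
  sides of the transformation law and passes through the matrix products.\<close>

lemma riemannian_metric_conformal_metric:
  assumes atlas: "smooth_atlas X \<A>" and g: "riemannian_metric \<A> g" and u: "smooth_function \<A> u"
  shows "riemannian_metric \<A> (conformal_metric u g)"
  unfolding riemannian_metric_def
proof (intro conjI ballI allI impI)
  fix c
  assume c: "c \<in> \<A>"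
  note chart = atlas_chart[OF atlas c]
  have "smooth_on (\<lambda>x. 2 * u (inv_coord c x)) (ran_of c)"
    using u c smooth_on_bilinear[OF chart_open[OF chart] bounded_bilinear_mult
        smooth_on_const[OF chart_open[OF chart]]]
    by (auto simp: smooth_function_def o_def)
  from smooth_on_compose[OF chart_open[OF chart] smooth_on_exp this]
  have "smooth_on (\<lambda>x. exp (2 * u (inv_coord c x))) (ran_of c)"
    by simp
  from smooth_on_bilinear[OF chart_open[OF chart] bounded_bilinear_scaleR this metric_smooth[OF g c]]
  show "smooth_on (conformal_metric u g c) (ran_of c)"
    by (simp add: conformal_metric_def[abs_def])
  fix x
  assume x: "x \<in> ran_of c"
  show "transpose (conformal_metric u g c x) = conformal_metric u g c x"
    using g c x by (simp add: conformal_metric_def riemannian_metric_def transpose_scalar)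
  show "v \<bullet> (conformal_metric u g c x *v v) > 0" if "v \<noteq> 0" for v
    using metric_pos[OF g c x that] by (simp add: conformal_metric_def scaleR_matrix_vector_assoc[symmetric])
next
  fix c d p
  assume c: "c \<in> \<A>" and d: "d \<in> \<A>" and p: "p \<in> dom_of c \<inter> dom_of d"
  then have "inv_coord c (coord c p) = p" "inv_coord d (coord d p) = p"
    using inv_coord_coord[OF atlas_chart[OF atlas]] by blast+
  moreover have "let J = matrix (frechet_derivative (transition c d) (at (coord c p)))
      in g c (coord c p) = transpose J ** g d (coord d p) ** J"
    using g c d p by (simp add: riemannian_metric_def)
  ultimately show "let J = matrix (frechet_derivative (transition c d) (at (coord c p)))
      in conformal_metric u g c (coord c p) = transpose J ** conformal_metric u g d (coord d p) ** J"
    by (simp add: Let_def conformal_metric_def matrix_scalar_ac scalar_matrix_assoc)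
qed

section \<open>Area\<close>

text \<open>Bridges the gauge integral delivered by the fundamental theorem of calculus and the
  Lebesgue integral defining length. Only the positive part survives \<open>ennreal\<close>; if its
  integral is infinite nothing is to be shown, and otherwise it is a gauge integral dominating that
  of \<open>f\<close>.\<close>

lemma ennreal_has_integral_le_nn_integral:
  fixes f :: "'a::euclidean_space \<Rightarrow> real"
  assumes "(f has_integral I) S"
  shows "ennreal I \<le> (\<integral>\<^sup>+x\<in>S. ennreal (f x) \<partial>lborel)"
proof -
  define w where "w = (\<lambda>x. max 0 (indicator S x * f x))"
  have w: "(\<integral>\<^sup>+x\<in>S. ennreal (f x) \<partial>lborel) = (\<integral>\<^sup>+x. ennreal (w x) \<partial>lebesgue)"
    unfolding nn_integral_completion
    by (intro nn_integral_cong) (auto simp: w_def indicator_def max_def ennreal_neg)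
  have meas: "w \<in> borel_measurable lebesgue"
    unfolding w_def using has_integral_implies_lebesgue_measurable[OF assms]
    by (intro borel_measurable_max) auto
  show ?thesis
  proof (cases "(\<integral>\<^sup>+x. ennreal (w x) \<partial>lebesgue)")
    case (real r)
    then have "(w has_integral r) UNIV"
      using meas by (subst has_integral_iff_nn_integral_lebesgue) (auto simp: w_def)
    moreover have "((\<lambda>x. if x \<in> S then f x else 0) has_integral I) UNIV"
      using assms by (simp add: has_integral_restrict_UNIV)
    ultimately have "I \<le> r"
      using has_integral_le[of "\<lambda>x. if x \<in> S then f x else 0" I UNIV w r] by (auto simp: w_def)
    then show ?thesis
      unfolding w real(2) by (rule ennreal_leI)
  qed (simp add: w)
qed

lemma borel_measurable_ennreal_indicator:
  fixes h :: "'a::euclidean_space \<Rightarrow> real"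
  assumes "open T" "continuous_on T h" "S \<in> sets borel" "S \<subseteq> T"
  shows "(\<lambda>x. ennreal (h x) * indicator S x) \<in> borel_measurable borel"
proof -
  have "(\<lambda>x. h x * indicator S x) \<in> borel_measurable borel"
    using borel_measurable_continuous_on_indicator[OF assms(3) continuous_on_subset[OF assms(2,4)]]
    by (simp add: mult.commute)
  then have "(\<lambda>x. ennreal (h x * indicator S x)) \<in> borel_measurable borel"
    by measurable
  moreover have "ennreal (h x) * indicator S x = ennreal (h x * indicator S x)" for x
    by (auto simp: indicator_def)
  ultimately show ?thesis by simp
qed

text \<open>On the k-th dyadic annulus the integrand is at most 4^(k+1) / R^2, while the disc of
  radius R / 2^k has area \<pi> R^2 / 4^k. Each of the n + 1 scales thus contributes at most 4
  \<pi>; this is the logarithmic growth in discrete form.\<close>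

lemma nn_integral_annuli_le:
  fixes x0 :: "real^2"
  assumes "R > 0"
  shows "(\<integral>\<^sup>+x\<in>ball x0 R. ennreal (1 / ((norm (x - x0))\<^sup>2 + (R / 2 ^ n)\<^sup>2)) \<partial>lborel)
    \<le> ennreal (4 * pi * (n + 1))"
proof -
  \<comment> \<open>The alternative k = m is the innermost disc, which has no inner radius; there
    the summand (R / 2^n)^2 in the denominator takes over.\<close>
  have dyadic: "\<exists>k\<le>m. d < R / 2 ^ k \<and> (k = m \<or> R / 2 ^ (k + 1) \<le> d)" if "d < R" for d m
  proof (induction m)
    case 0
    then show ?case using that by simp
  next
    case (Suc m)
    then obtain k where k: "k \<le> m" "d < R / 2 ^ k" "k = m \<or> R / 2 ^ (k + 1) \<le> d"
      by blast
    show ?case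
    proof (cases "R / 2 ^ (k + 1) \<le> d")
      case True
      then show ?thesis using k by (intro exI[of _ k]) auto
    next
      case False
      then show ?thesis using k by (intro exI[of _ "Suc m"]) auto
    qed
  qed
  have le: "ennreal (1 / ((norm (x - x0))\<^sup>2 + (R / 2 ^ n)\<^sup>2)) * indicator (ball x0 R) x
    \<le> (\<Sum>k\<le>n. ennreal (4 ^ (k + 1) / R\<^sup>2) * indicator (ball x0 (R / 2 ^ k)) x)" for x
  proof (cases "x \<in> ball x0 R")
    case True
    let ?d = "norm (x - x0)"
    have "?d < R"
      using True by (simp add: dist_norm norm_minus_commute)
    from dyadic[OF this, of n] obtain k
      where k: "k \<le> n" "?d < R / 2 ^ k" "k = n \<or> R / 2 ^ (k + 1) \<le> ?d" by blast
    have "(R / 2 ^ (k + 1))\<^sup>2 \<le> ?d\<^sup>2 + (R / 2 ^ n)\<^sup>2"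
      using k(3)
    proof
      assume "k = n"
      moreover have "(R / 2 ^ (n + 1))\<^sup>2 \<le> (R / 2 ^ n)\<^sup>2"
        using assms by (intro power_mono) (auto simp: field_simps)
      ultimately show ?thesis by (simp add: add_increasing)
    next
      assume "R / 2 ^ (k + 1) \<le> ?d"
      then have "(R / 2 ^ (k + 1))\<^sup>2 \<le> ?d\<^sup>2"
        using assms by (intro power_mono) auto
      then show ?thesis by (simp add: add_increasing2)
    qed
    then have "1 / (?d\<^sup>2 + (R / 2 ^ n)\<^sup>2) \<le> 1 / (R / 2 ^ (k + 1))\<^sup>2"
      using assms by (intro divide_left_mono mult_pos_pos) (auto intro: add_nonneg_pos)
    also have "\<dots> = 4 ^ (k + 1) / R\<^sup>2"
      by (simp add: power_divide power_mult_distrib power2_eq_square flip: power_mult_distrib)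
    finally have "ennreal (1 / (?d\<^sup>2 + (R / 2 ^ n)\<^sup>2)) \<le>
        ennreal (4 ^ (k + 1) / R\<^sup>2) * indicator (ball x0 (R / 2 ^ k)) x"
      using k(2) by (simp add: dist_norm norm_minus_commute ennreal_leI)
    \<comment> \<open>Summing over full discs instead of annuli overcounts only by a constant factor
      and keeps the areas simple.\<close>
    also have "\<dots> \<le> (\<Sum>k\<le>n. ennreal (4 ^ (k + 1) / R\<^sup>2) * indicator (ball x0 (R / 2 ^ k)) x)"
      using k(1) by (intro member_le_sum) auto
    finally show ?thesis using True by simp
  qed simp
  have annulus: "ennreal (4 ^ (k + 1) / R\<^sup>2) * emeasure lborel (ball x0 (R / 2 ^ k)) = ennreal (4 * pi)" for k
  proof -
    have "emeasure lborel (ball x0 (R / 2 ^ k)) = ennreal (pi * (R / 2 ^ k)\<^sup>2)"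
      using assms by (subst emeasure_ball) (auto simp: unit_ball_vol_2)
    moreover have "4 ^ (k + 1) / R\<^sup>2 * (pi * (R / 2 ^ k)\<^sup>2) = 4 * pi"
      using assms by (simp add: field_simps power2_eq_square flip: power_mult_distrib)
    ultimately show ?thesis
      by (simp add: ennreal_mult'[symmetric])
  qed
  have "(\<integral>\<^sup>+x\<in>ball x0 R. ennreal (1 / ((norm (x - x0))\<^sup>2 + (R / 2 ^ n)\<^sup>2)) \<partial>lborel)
    \<le> (\<integral>\<^sup>+x. (\<Sum>k\<le>n. ennreal (4 ^ (k + 1) / R\<^sup>2) * indicator (ball x0 (R / 2 ^ k)) x) \<partial>lborel)"
    by (intro nn_integral_mono le)
  also have "\<dots> = (\<Sum>k\<le>n. ennreal (4 ^ (k + 1) / R\<^sup>2) * emeasure lborel (ball x0 (R / 2 ^ k)))"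
    by (subst nn_integral_sum) (auto simp only: nn_integral_cmult_indicator sets_lborel borel_open open_ball
        intro!: borel_measurable_times_ennreal borel_measurable_const borel_measurable_indicator)
  also have "\<dots> = (\<Sum>k\<le>n. ennreal (4 * pi))"
    by (intro sum.cong refl annulus)
  also have "\<dots> = ennreal (4 * pi * (n + 1))"
    by (simp add: ennreal_of_nat_eq_real_of_nat ennreal_mult'[symmetric] algebra_simps)
  finally show ?thesis .
qed

section \<open>Area density and its conformal change\<close>

lemma pos_def_det_pos:
  fixes M :: "real^2^2"
  assumes "transpose M = M" "\<And>v. v \<noteq> 0 \<Longrightarrow> v \<bullet> (M *v v) > 0"
  shows "det M > 0"
proof -
  have sym: "M $ 2 $ 1 = M $ 1 $ 2"
    using arg_cong[OF assms(1), of "\<lambda>N. N $ 1 $ 2"] by (simp add: transpose_def)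
  have q: "v \<bullet> (M *v v) = v $ 1 * (M $ 1 $ 1 * v $ 1 + M $ 1 $ 2 * v $ 2)
      + v $ 2 * (M $ 1 $ 2 * v $ 1 + M $ 2 $ 2 * v $ 2)" for v
    by (simp add: inner_vec_def matrix_vector_mult_def sum_2 sym)
  have pos: "M $ 1 $ 1 > 0"
    using assms(2)[of "vector [1, 0]"] unfolding q by (simp add: vec_eq_iff forall_2)
  \<comment> \<open>The test vector is orthogonal to the first row of M, so the form takes the value
    \<open>M $ 1 $ 1\<close> times the determinant on it.\<close>
  then have "M $ 1 $ 1 * (M $ 1 $ 1 * M $ 2 $ 2 - (M $ 1 $ 2)\<^sup>2) > 0"
    using assms(2)[of "vector [- (M $ 1 $ 2), M $ 1 $ 1]"] unfolding q
    by (simp add: vec_eq_iff forall_2 algebra_simps power2_eq_square)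
  with pos show ?thesis
    by (simp add: det_2 sym zero_less_mult_iff power2_eq_square)
qed

text \<open>Here dimension two enters: the determinant scales by the square, hence the area density
  linearly in the conformal factor.\<close>

lemma sqrt_det_scaleR:
  fixes M :: "real^2^2"
  assumes "k \<ge> 0"
  shows "sqrt (det (k *\<^sub>R M)) = k * sqrt (det M)"
proof -
  have "det (k *\<^sub>R M) = k\<^sup>2 * det M"
    by (simp add: det_2 power2_eq_square algebra_simps)
  then show ?thesis using assms by (simp add: real_sqrt_mult)
qed

abbreviation area_density :: "'a metric_field \<Rightarrow> 'a chart \<Rightarrow> real^2 \<Rightarrow> real" where
  "area_density g c x \<equiv> sqrt (det (g c x))"

lemma continuous_on_area_density:
  assumes "riemannian_metric \<A> g" "c \<in> \<A>"
  shows "continuous_on (ran_of c) (area_density g c)"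
proof -
  have "continuous_on (ran_of c) (g c)"
    by (rule smooth_on_imp_continuous[OF metric_smooth[OF assms]])
  then show ?thesis
    unfolding det_2 by (intro continuous_intros)
qed

lemma finite_chart_cover_exists:
  assumes "compact_space X" "smooth_atlas X \<A>"
  shows "\<exists>cs. finite_chart_cover X \<A> cs"
proof -
  have "\<exists>\<F>. finite \<F> \<and> \<F> \<subseteq> dom_of ` \<A> \<and> topspace X \<subseteq> \<Union>\<F>"
    using assms(1)[unfolded compact_space_alt, rule_format, of "dom_of ` \<A>"]
      atlas_cover[OF assms(2)] chart_openin[OF atlas_chart[OF assms(2)]] by auto
  then obtain C where C: "finite C" "C \<subseteq> \<A>" "topspace X \<subseteq> (\<Union>c\<in>C. dom_of c)"
    by (metis finite_subset_image)
  obtain cs where "set cs = C"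
    using finite_list[OF C(1)] by blast
  with C have "finite_chart_cover X \<A> cs"
    using atlas_cover[OF assms(2)] unfolding finite_chart_cover_def by blast
  then show ?thesis ..
qed

text \<open>
  Since \<open>total_area\<close> evaluates all metrics by the same cover, the bump may be placed in the first
  nonempty chart of that cover.  It then vanishes on all other pieces of the decomposition, and
  no change of variables is needed.
\<close>

lemma area_via_conformal_bump:
  fixes f :: "real^2 \<Rightarrow> real"
  assumes atlas: "smooth_atlas X \<A>" and cs: "set cs \<subseteq> \<A>" and g: "riemannian_metric \<A> g"
    and i: "i < length cs" "\<And>j. j < i \<Longrightarrow> dom_of (cs ! j) = {}"
    and f: "continuous_on (ran_of (cs ! i)) f" "\<And>x. x \<in> ran_of (cs ! i) \<Longrightarrow> f x \<ge> 0"
    and k: "k \<ge> 0"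
    and u: "\<And>p. exp (2 * u p) = extend_by (cs ! i) (\<lambda>x. k + f x) k p"
  shows "area_via (conformal_metric u g) cs = ennreal k * area_via g cs
    + (\<integral>\<^sup>+x\<in>ran_of (cs ! i). ennreal (f x * area_density g (cs ! i) x) \<partial>lborel)"
proof -
  define E where "E j = coord (cs ! j) ` (dom_of (cs ! j) - (\<Union>l<j. dom_of (cs ! l)))" for j
  define I where "I = (\<integral>\<^sup>+x\<in>ran_of (cs ! i). ennreal (f x * area_density g (cs ! i) x) \<partial>lborel)"
  have in_atlas: "cs ! j \<in> \<A>" if "j < length cs" for j
    using cs that by auto
  note chart = atlas_chart[OF atlas in_atlas]
  have E: "E j \<in> sets borel" "E j \<subseteq> ran_of (cs ! j)" if "j < length cs" for j
  proof -
    have U: "openin X (\<Union>l<j. dom_of (cs ! l))"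
      using that chart_openin[OF chart] by (intro openin_Union) auto
    \<comment> \<open>Injectivity of the coordinate map exhibits the piece as a difference of two
      open planar sets, hence Borel.\<close>
    have "E j = ran_of (cs ! j) - coord (cs ! j) ` (dom_of (cs ! j) \<inter> (\<Union>l<j. dom_of (cs ! l)))"
      unfolding E_def ran_of_def
      using inj_on_image_set_diff[OF chart_inj[OF chart[OF that]] Diff_subset
          Int_lower1[of _ "\<Union>l<j. dom_of (cs ! l)"]] by (simp only: Diff_Int) simp
    then show "E j \<in> sets borel" "E j \<subseteq> ran_of (cs ! j)"
      using open_coord_image[OF chart[OF that] U] chart_open[OF chart[OF that]] by auto
  qed
  have dens: "area_density (conformal_metric u g) (cs ! j) x =
      extend_by (cs ! i) (\<lambda>x. k + f x) k (inv_coord (cs ! j) x) * area_density g (cs ! j) x" for j x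
    unfolding u[symmetric] conformal_metric_def by (rule sqrt_det_scaleR) simp
  have piece: "(\<integral>\<^sup>+x\<in>E j. ennreal (area_density (conformal_metric u g) (cs ! j) x) \<partial>lborel)
    = ennreal k * (\<integral>\<^sup>+x\<in>E j. ennreal (area_density g (cs ! j) x) \<partial>lborel) + (if j = i then I else 0)"
    if j: "j < length cs" for j
  proof -
    let ?\<rho> = "area_density g (cs ! j)"
    have m: "(\<lambda>x. ennreal (?\<rho> x) * indicator (E j) x) \<in> borel_measurable borel"
      by (rule borel_measurable_ennreal_indicator[OF chart_open[OF chart[OF j]] continuous_on_area_density[OF g in_atlas[OF j]] E[OF j]])
    show ?thesis
    proof (cases "j = i")
      case True
      have Ei: "E i = ran_of (cs ! i)"
        using i(2) by (auto simp: E_def ran_of_def)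
      have "(\<integral>\<^sup>+x\<in>E j. ennreal (area_density (conformal_metric u g) (cs ! j) x) \<partial>lborel)
        = (\<integral>\<^sup>+x. ennreal k * (ennreal (?\<rho> x) * indicator (E j) x) + ennreal (f x * ?\<rho> x) * indicator (E j) x \<partial>lborel)"
      proof (rule nn_integral_cong)
        fix x
        show "ennreal (area_density (conformal_metric u g) (cs ! j) x) * indicator (E j) x =
          ennreal k * (ennreal (?\<rho> x) * indicator (E j) x) + ennreal (f x * ?\<rho> x) * indicator (E j) x"
        proof (cases "x \<in> E j")
          case x: True
          then have x: "x \<in> ran_of (cs ! i)" using True Ei by simp
          have "det (g (cs ! j) x) > 0"
            using g in_atlas[OF j] x True by (intro pos_def_det_pos) (auto simp: riemannian_metric_def)
          then have "?\<rho> x \<ge> 0" by simp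
          then show ?thesis
            using k f(2)[OF x] x
            by (simp add: dens True extend_by_def inv_coord_in_dom coord_inv_coord
                ennreal_mult'[symmetric] ennreal_plus[symmetric] distrib_right indicator_def
                del: ennreal_plus)
        qed simp
      qed
      also have "\<dots> = ennreal k * (\<integral>\<^sup>+x\<in>E j. ennreal (?\<rho> x) \<partial>lborel) + I"
      proof -
        have "(\<lambda>x. ennreal (f x * ?\<rho> x) * indicator (E j) x) \<in> borel_measurable borel"
          using True Ei f(1)
          by (intro borel_measurable_ennreal_indicator[OF chart_open[OF chart[OF j]] _ E[OF j]]
              continuous_on_mult continuous_on_area_density[OF g in_atlas[OF j]]) auto
        with m show ?thesis
          using True Ei by (simp add: nn_integral_add nn_integral_cmult I_def)
      qed
      finally show ?thesis using True by simp
    next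
      case False
      have "ennreal (area_density (conformal_metric u g) (cs ! j) x) * indicator (E j) x =
        ennreal k * (ennreal (?\<rho> x) * indicator (E j) x)" for x
      proof (cases "x \<in> E j")
        case True
        \<comment> \<open>Pieces before \<open>i\<close> are empty, and pieces after
          \<open>i\<close> have the domain of chart \<open>i\<close> removed, so the bump is not
          seen on either.\<close>
        then have "i < j"
          using i(2)[of j] False by (cases "j < i") (auto simp: E_def)
        then have "inv_coord (cs ! j) x \<notin> dom_of (cs ! i)"
          using True inv_coord_coord[OF chart[OF j]] by (auto simp: E_def)
        then show ?thesis
          using k by (simp add: dens extend_by_def ennreal_mult' mult.assoc)
      qed simp
      then show ?thesis
        using m False by (simp add: nn_integral_cmult)
    qed
  qed
  have "area_via (conformal_metric u g) cs
    = (\<Sum>j<length cs. ennreal k * (\<integral>\<^sup>+x\<in>E j. ennreal (area_density g (cs ! j) x) \<partial>lborel) + (if j = i then I else 0))"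
    unfolding area_via_def E_def[symmetric] by (intro sum.cong refl piece) simp
  also have "\<dots> = ennreal k * area_via g cs + I"
    using i(1) by (simp add: sum.distrib sum_distrib_left area_via_def E_def)
  finally show ?thesis by (simp add: I_def)
qed

section \<open>Length of curves leaving a disc\<close>

text \<open>\<open>T\<close> is the first time outside the open disc; it exists because the set of
  such times is compact. Just before \<open>T\<close> the curve is in the open disc and the closed
  disc is closed in \<open>X\<close>, so at \<open>T\<close> it lies on the bounding circle.\<close>

lemma curve_exit:
  assumes chart: "is_chart X c" and X: "Hausdorff_space X" and \<gamma>: "pathin X \<gamma>"
    and r: "cball x0 r \<subseteq> ran_of c"
    and start: "\<gamma> 0 \<in> inv_coord c ` ball x0 r" and finish: "\<gamma> 1 \<notin> inv_coord c ` ball x0 r"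
  obtains T where "0 \<le> T" "T \<le> 1" "\<And>t. t \<in> {0..T} \<Longrightarrow> \<gamma> t \<in> inv_coord c ` cball x0 r"
    "norm (coord c (\<gamma> T) - x0) = r"
proof -
  have ball: "ball x0 r \<subseteq> ran_of c"
    using r ball_subset_cball by blast
  have cont: "continuous_map (top_of_set {0..1}) X \<gamma>"
    using \<gamma> by (simp add: pathin_def)
  let ?S = "{t \<in> {0..1}. \<gamma> t \<in> topspace X - inv_coord c ` ball x0 r}"
  let ?C = "{t \<in> {0..1}. \<gamma> t \<in> inv_coord c ` cball x0 r}"
  have "closedin (top_of_set {0..1}) ?S"
    using closedin_continuous_map_preimage[OF cont
        closedin_diff[OF closedin_topspace openin_inv_coord_image[OF chart open_ball ball]]] by simp
  then have S: "closed ?S"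
    by (rule closedin_closed_trans) simp
  have "closedin (top_of_set {0..1}) ?C"
    using closedin_continuous_map_preimage[OF cont
        closedin_inv_coord_image[OF chart X compact_cball r]] by simp
  then have C: "closed ?C"
    by (rule closedin_closed_trans) simp
  have top: "\<gamma> t \<in> topspace X" if "t \<in> {0..1}" for t
    using continuous_map_image_subset_topspace[OF cont] that by auto
  have "compact ?S"
    using S bounded_subset[OF bounded_closed_interval[of 0 1], of ?S]
    unfolding compact_eq_bounded_closed by blast
  moreover have "?S \<noteq> {}"
    using finish top[of 1] by auto
  ultimately have "\<exists>T\<in>?S. \<forall>t\<in>?S. T \<le> t"
    by (rule compact_attains_inf)
  then obtain T where T: "T \<in> ?S" "\<forall>t\<in>?S. T \<le> t" ..
  have before: "\<gamma> t \<in> inv_coord c ` ball x0 r" if "t \<in> {0..<T}" for t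
      proof (rule ccontr)
    assume "\<gamma> t \<notin> inv_coord c ` ball x0 r"
    then have "t \<in> ?S"
      using that T(1) top[of t] by auto
    from bspec[OF T(2) this] show False using that by simp
  qed
  have "T \<noteq> 0"
    using T(1) start by auto
  then have "T > 0" using T(1) by auto
  have "{0..<T} \<subseteq> ?C"
    using before T(1) ball_subset_cball[of x0 r] by fastforce
  then have "closure {0..<T} \<subseteq> ?C"
    using C by (rule closure_minimal)
  then have in_C: "{0..T} \<subseteq> ?C"
    using \<open>T > 0\<close> by simp
  moreover have "T \<in> {0..T}"
    using \<open>T > 0\<close> by simp
  ultimately have "T \<in> ?C" ..
  then obtain x where x: "x \<in> cball x0 r" "\<gamma> T = inv_coord c x"
    by auto
  then have "x \<notin> ball x0 r" using T(1) by auto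
  then have "norm (coord c (\<gamma> T) - x0) = r"
    using x r coord_inv_coord[of x c] by (auto simp: dist_norm norm_minus_commute)
  then show ?thesis
    using that[of T] T(1) subsetD[OF in_C] by simp
qed

section \<open>Velocity and speed in a prescribed chart\<close>

lemma chart_at:
  assumes "smooth_atlas X \<A>" "p \<in> topspace X"
  shows "chart_at \<A> p \<in> \<A>" "p \<in> dom_of (chart_at \<A> p)"
proof -
  have "\<exists>c. c \<in> \<A> \<and> p \<in> dom_of c"
    using assms(2) atlas_cover[OF assms(1)] by blast
  from someI_ex[OF this] show "chart_at \<A> p \<in> \<A>" "p \<in> dom_of (chart_at \<A> p)"
    by (simp_all add: chart_at_def)
qed

text \<open>\<open>speed\<close> uses an arbitrarily chosen chart. The chain rule for the transition
  map and the tensor law for the metric cancel, so a chart fixed in advance gives the same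
  value.\<close>

lemma speed_in_chart:
  assumes atlas: "smooth_atlas X \<A>" and g: "riemannian_metric \<A> g" and c: "c \<in> \<A>"
    and \<gamma>: "pathin X \<gamma>" and t: "0 < t" "t < 1" "\<gamma> t \<in> dom_of c"
    and v: "((coord c \<circ> \<gamma>) has_vector_derivative v) (at t)"
  shows "speed \<A> g \<gamma> t = sqrt (v \<bullet> (g c (coord c (\<gamma> t)) *v v))"
proof -
  define d where "d = chart_at \<A> (\<gamma> t)"
  have d: "d \<in> \<A>" "\<gamma> t \<in> dom_of d"
    using chart_at[OF atlas] t(3) chart_dom_subset[OF atlas_chart[OF atlas c]] by (auto simp: d_def)
  note chart_c = atlas_chart[OF atlas c] and chart_d = atlas_chart[OF atlas d(1)]
  define \<tau> where "\<tau> = transition c d"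
  define L where "L = frechet_derivative \<tau> (at (coord c (\<gamma> t)))"
  have L: "(\<tau> has_derivative L) (at (coord c (\<gamma> t)))"
    unfolding L_def \<tau>_def using t(3) d(2)
    by (intro smooth_on_has_derivative[OF atlas_transition[OF atlas c d(1)]]) auto
  \<comment> \<open>The preimage is only relatively open in [0, 1]; cutting with the open interval
    yields a genuine neighbourhood of \<open>t\<close>, as the two-sided derivative
    requires.\<close>
  let ?W = "{s \<in> {0..1}. \<gamma> s \<in> dom_of c \<inter> dom_of d} \<inter> {0<..<1}"
  have "openin (top_of_set {0..1}) {s \<in> topspace (top_of_set {0..1}). \<gamma> s \<in> dom_of c \<inter> dom_of d}"
    using \<gamma> openin_Int[OF chart_openin[OF chart_c] chart_openin[OF chart_d]]
    unfolding pathin_def by (intro openin_continuous_map_preimage)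
  then obtain U where U: "open U" "{s \<in> {0..1}. \<gamma> s \<in> dom_of c \<inter> dom_of d} = {0..1} \<inter> U"
    by (auto simp: openin_open)
  have "?W = U \<inter> {0<..<1}"
    unfolding U(2) by auto
  then have W: "open ?W"
    using U(1) by auto
  have "((\<tau> \<circ> (coord c \<circ> \<gamma>)) has_vector_derivative L v) (at t)"
    using vector_derivative_diff_chain_within[OF v, of \<tau> L] L
    by (metis comp_apply has_derivative_at_withinI)
  then have "((coord d \<circ> \<gamma>) has_vector_derivative L v) (at t)"
    by (rule has_vector_derivative_transform_within_open[OF _ W])
      (use t d in \<open>auto simp: \<tau>_def transition_def inv_coord_coord[OF chart_c]\<close>)
  then have vd: "vector_derivative (coord d \<circ> \<gamma>) (at t) = L v"
    by (rule vector_derivative_at)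
  define J where "J = matrix L"
  have Lv: "L v = J *v v"
    unfolding J_def using has_derivative_linear[OF L] by simp
  have law: "g c (coord c (\<gamma> t)) = transpose J ** g d (coord d (\<gamma> t)) ** J"
    using g c d t(3) unfolding riemannian_metric_def J_def L_def \<tau>_def Let_def by blast
  have "v \<bullet> (g c (coord c (\<gamma> t)) *v v) = v \<bullet> (transpose J *v (g d (coord d (\<gamma> t)) *v (J *v v)))"
    unfolding law by (simp add: matrix_vector_mul_assoc matrix_mul_assoc)
  also have "\<dots> = L v \<bullet> (g d (coord d (\<gamma> t)) *v L v)"
    unfolding Lv by (metis dot_lmul_matrix inner_commute transpose_matrix_vector)
  finally show ?thesis
    by (simp add: speed_def Let_def d_def[symmetric] vd)
qed

lemma partition_interval:
  fixes s :: "nat \<Rightarrow> real"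
  assumes "s 0 \<le> t" "t \<le> s n" "t \<notin> s ` {..n}"
  shows "\<exists>i<n. s i < t \<and> t < s (Suc i)"
  using assms
proof (induction n)
  case 0
  then show ?case by auto
next
  case (Suc n)
  show ?case
  proof (cases "t \<le> s n")
    case True
    then have "\<exists>i<n. s i < t \<and> t < s (Suc i)"
      using Suc by (intro Suc.IH) auto
    then show ?thesis using less_SucI by blast
  next
    case False
    then show ?thesis using Suc.prems by (intro exI[of _ n]) force
  qed
qed

lemma piecewise_C1_curve_differentiable:
  assumes "piecewise_C1_curve X \<A> \<gamma>"
  obtains B where "finite B"
    "\<And>c t. c \<in> \<A> \<Longrightarrow> 0 < t \<Longrightarrow> t < 1 \<Longrightarrow> t \<notin> B \<Longrightarrow> \<gamma> t \<in> dom_of c \<Longrightarrow>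
      ((coord c \<circ> \<gamma>) has_vector_derivative vector_derivative (coord c \<circ> \<gamma>) (at t)) (at t)"
proof -
  obtain n s where s: "s 0 = 0" "s n = 1" "\<And>i. i < n \<Longrightarrow> C1_curve_on \<A> \<gamma> (s i) (s (Suc i))"
    using assms unfolding piecewise_C1_curve_def by blast
  show ?thesis
  proof (rule that[of "s ` {..n}"])
    fix c t
    assume c: "c \<in> \<A>" and t: "0 < t" "t < 1" "t \<notin> s ` {..n}" "\<gamma> t \<in> dom_of c"
    obtain i where i: "i < n" "s i < t" "t < s (Suc i)"
      using partition_interval[of s t n] s(1,2) t by auto
    obtain D where "\<And>t. t \<in> {s i..s (Suc i)} \<Longrightarrow> \<gamma> t \<in> dom_of c \<Longrightarrow>
        ((coord c \<circ> \<gamma>) has_vector_derivative D t) (at t within {s i..s (Suc i)})"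
      using s(3)[OF i(1)] c unfolding C1_curve_on_def by blast
    \<comment> \<open>Inside a piece the derivative within the closed interval is the full
      derivative; only break points have to be excluded, whatever the chart.\<close>
    from this[of t] have "((coord c \<circ> \<gamma>) has_vector_derivative D t) (at t)"
      using i t(4) by (simp add: at_within_Icc_at)
    then show "((coord c \<circ> \<gamma>) has_vector_derivative vector_derivative (coord c \<circ> \<gamma>) (at t)) (at t)"
      by (simp add: vector_derivative_at)
  qed auto
qed

text \<open>
  The length is bounded below by the increment of \<open>\<kappa> / 2 * ln (\<bar>x - x0\<bar>\<^sup>2 + \<epsilon>\<^sup>2)\<close>, which is
  \<open>1\<close>-Lipschitz for the metric on the disc, along the curve up to its first exit from the disc.
\<close>

lemma curve_length_ge:
  assumes atlas: "smooth_atlas X \<A>" and X: "Hausdorff_space X" and g: "riemannian_metric \<A> g"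
    and c: "c \<in> \<A>" and r: "cball x0 r \<subseteq> ran_of c" "r > 0" and \<kappa>: "\<kappa> \<ge> 0" and \<epsilon>: "\<epsilon> \<noteq> 0"
    and bound: "\<And>x v. x \<in> cball x0 r \<Longrightarrow>
      \<kappa>\<^sup>2 * (v \<bullet> v) / ((norm (x - x0))\<^sup>2 + \<epsilon>\<^sup>2) \<le> v \<bullet> (g c x *v v)"
    and \<gamma>: "piecewise_C1_curve X \<A> \<gamma>" "\<gamma> 0 = inv_coord c x0" "\<gamma> 1 \<notin> inv_coord c ` ball x0 r"
  shows "ennreal (\<kappa> / 2 * ln ((r\<^sup>2 + \<epsilon>\<^sup>2) / \<epsilon>\<^sup>2)) \<le> curve_length \<A> g \<gamma>"
proof -
  note chart = atlas_chart[OF atlas c]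
  have path: "pathin X \<gamma>"
    using \<gamma>(1) by (simp add: piecewise_C1_curve_def)
  have x0: "x0 \<in> ran_of c"
    using r by auto
  have "\<gamma> 0 \<in> inv_coord c ` ball x0 r"
    using \<gamma>(2) r(2) by auto
  from curve_exit[OF chart X path r(1) this \<gamma>(3)]
  obtain T where T: "0 \<le> T" "T \<le> 1" "\<And>t. t \<in> {0..T} \<Longrightarrow> \<gamma> t \<in> inv_coord c ` cball x0 r"
    "norm (coord c (\<gamma> T) - x0) = r" by blast
  obtain B where B: "finite B"
    "\<And>t. 0 < t \<Longrightarrow> t < 1 \<Longrightarrow> t \<notin> B \<Longrightarrow> \<gamma> t \<in> dom_of c \<Longrightarrow>
      ((coord c \<circ> \<gamma>) has_vector_derivative vector_derivative (coord c \<circ> \<gamma>) (at t)) (at t)"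
    using piecewise_C1_curve_differentiable[OF \<gamma>(1)] c by metis
  define y where "y = coord c \<circ> \<gamma>"
  define v where "v t = vector_derivative y (at t)" for t
  define N where "N t = (y t - x0) \<bullet> (y t - x0) + \<epsilon>\<^sup>2" for t
  have N: "N t > 0" for t
    using \<epsilon> by (simp add: N_def add_nonneg_pos)
  have dom: "\<gamma> t \<in> dom_of c" and y_cball: "y t \<in> cball x0 r" if "t \<in> {0..T}" for t
    using T(3)[OF that] r(1) by (auto simp: y_def coord_inv_coord inv_coord_in_dom subset_iff)
  have v: "(y has_vector_derivative v t) (at t)" if "t \<in> {0<..<T} - B" for t
    using B(2)[of t] dom[of t] that T(2) by (simp add: y_def v_def)
  define F where "F t = \<kappa> / 2 * ln (N t)" for t
  define f where "f t = \<kappa> * ((y t - x0) \<bullet> v t) / N t" for t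
  \<comment> \<open>Continuity is claimed up to \<open>T\<close> only, since later the curve may
    leave the chart domain, where \<open>coord c\<close> is arbitrary.\<close>
  have cont_y: "continuous_on {0..T} y"
  proof -
    have "continuous_map (subtopology (top_of_set {0..1}) {0..T}) (subtopology X (dom_of c)) \<gamma>"
      using continuous_map_from_subtopology[OF path[unfolded pathin_def]] dom
      by (intro continuous_map_into_subtopology) auto
    moreover have "subtopology (top_of_set {0..1}) {0..T} = top_of_set {0..T}"
      using T(2) by (simp add: subtopology_subtopology Int_absorb1)
    ultimately have "continuous_map (top_of_set {0..T}) (top_of_set (ran_of c)) y"
      unfolding y_def using continuous_map_compose
        homeomorphic_imp_continuous_map[OF chart_homeomorphic[OF chart]] by metis
    then show ?thesis
      by (simp add: continuous_map_in_subtopology)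
  qed
  have "(f has_integral F T - F 0) {0..T}"
  proof (rule fundamental_theorem_of_calculus_interior_strong[OF B(1) T(1)])
    show "(F has_vector_derivative f t) (at t)" if "t \<in> {0<..<T} - B" for t
    proof -
      have "((\<lambda>t. y t - x0) has_derivative (\<lambda>h. h *\<^sub>R v t)) (at t)"
        using has_derivative_diff[OF v[OF that, unfolded has_vector_derivative_def] has_derivative_const]
        by simp
      from has_derivative_add[OF has_derivative_inner[OF this this] has_derivative_const]
      have "(N has_real_derivative 2 * ((y t - x0) \<bullet> v t)) (at t)"
        unfolding N_def has_field_derivative_def
        by (rule has_derivative_eq_rhs) (simp add: fun_eq_iff inner_commute algebra_simps)
      then have "(F has_real_derivative f t) (at t)"
        unfolding F_def using N[of t] by (auto intro!: derivative_eq_intros simp: f_def)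
      then show ?thesis
        by (simp add: has_real_derivative_iff_has_vector_derivative)
    qed
    show "continuous_on {0..T} F"
      unfolding F_def N_def using N by (intro continuous_intros cont_y) (auto simp: N_def less_imp_neq[symmetric])
  qed
  \<comment> \<open>\<open>f\<close> is negative where the curve turns back towards the centre;
    \<open>ennreal\<close> truncates this to 0, which only helps a lower bound.\<close>
  then have "ennreal (F T - F 0) \<le> (\<integral>\<^sup>+t\<in>{0..T}. ennreal (f t) \<partial>lborel)"
    by (rule ennreal_has_integral_le_nn_integral)
  also have "\<dots> \<le> (\<integral>\<^sup>+t\<in>{0..1}. ennreal (speed \<A> g \<gamma> t) \<partial>lborel)"
  proof (rule nn_integral_mono_AE)
    have "AE t in lborel. t \<notin> B \<union> {0, T}"
      using B(1) by (intro AE_not_in finite_imp_null_set_lborel) simp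
    then show "AE t in lborel. ennreal (f t) * indicator {0..T} t \<le>
        ennreal (speed \<A> g \<gamma> t) * indicator {0..1} t"
    proof eventually_elim
      case (elim t)
      show ?case
      proof (cases "t \<in> {0..T}")
        case True
        then have t: "t \<in> {0<..<T} - B"
          using elim by auto
        have "f t \<le> speed \<A> g \<gamma> t"
        proof -
          have "speed \<A> g \<gamma> t = sqrt (v t \<bullet> (g c (y t) *v v t))"
            using speed_in_chart[OF atlas g c path, of t "v t"] v[OF t] dom[OF True] t T(2)
            by (simp add: y_def)
          also have "\<dots> \<ge> sqrt (\<kappa>\<^sup>2 * (v t \<bullet> v t) / N t)"
            using bound[OF y_cball[OF True], of "v t"]
            by (simp add: N_def power2_norm_eq_inner)
          also have "sqrt (\<kappa>\<^sup>2 * (v t \<bullet> v t) / N t) = \<kappa> * norm (v t) / sqrt (N t)"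
            using \<kappa> by (simp add: real_sqrt_divide real_sqrt_mult norm_eq_sqrt_inner)
          finally have speed: "\<kappa> * norm (v t) / sqrt (N t) \<le> speed \<A> g \<gamma> t" .
          \<comment> \<open>With Cauchy-Schwarz this is the Lipschitz estimate: the derivative of
            \<open>F\<close> along the curve is at most \<kappa> |v| / sqrt N, the bound just
            obtained for the speed.\<close>
          have "norm (y t - x0) \<le> sqrt (N t)"
            by (simp add: norm_eq_sqrt_inner N_def)
          then have "(y t - x0) \<bullet> v t \<le> sqrt (N t) * norm (v t)"
            by (intro order_trans[OF norm_cauchy_schwarz] mult_right_mono) auto
          then have "f t \<le> \<kappa> * (sqrt (N t) * norm (v t)) / N t"
            unfolding f_def using \<kappa> N[of t] by (intro divide_right_mono mult_left_mono) auto
          also have "\<dots> = \<kappa> * norm (v t) / sqrt (N t)"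
            using N[of t] by (simp add: field_simps)
          finally show ?thesis using speed by simp
        qed
        then show ?thesis
          using True T(2) by (simp add: ennreal_leI)
      qed simp
    qed
  qed
  also have "F T - F 0 = \<kappa> / 2 * ln ((r\<^sup>2 + \<epsilon>\<^sup>2) / \<epsilon>\<^sup>2)"
  proof -
    have "N T = r\<^sup>2 + \<epsilon>\<^sup>2"
      using T(4) by (simp add: N_def y_def flip: power2_norm_eq_inner)
    moreover have "N 0 = \<epsilon>\<^sup>2"
      using \<gamma>(2) by (simp add: N_def y_def coord_inv_coord[OF x0])
    ultimately show ?thesis
      using N[of T] N[of 0] by (simp add: F_def ln_div right_diff_distrib)
  qed
  finally show ?thesis by (simp add: curve_length_def)
qed

section \<open>The conformal bump\<close>

text \<open>The empty space satisfies \<open>closed_smooth_surface\<close>, so a point to place the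
  bump at has to come from the genus. An empty space contains no circle, leaving only the empty
  family of curves.\<close>

lemma genus_pos_imp_nonempty:
  assumes "genus X > 0"
  shows "topspace X \<noteq> {}"
proof
  assume "topspace X = {}"
  have no_curve: "\<not> simple_closed_curve_in X C" for C
  proof
    assume "simple_closed_curve_in X C"
    then have "C = {}" "subtopology X C homeomorphic_space top_of_set (sphere (0::real^2) 1)"
      using \<open>topspace X = {}\<close> by (auto simp: simple_closed_curve_in_def)
    then obtain h where "h ` topspace (subtopology X C) = sphere (0::real^2) 1"
      unfolding homeomorphic_space by (metis homeomorphic_imp_surjective_map topspace_euclidean_subtopology)
    moreover obtain e :: "real^2" where "norm e = 1"
      using vector_choose_size[of 1] by auto
    then have "e \<in> sphere 0 1" by simp
    ultimately show False
      using \<open>C = {}\<close> by auto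
  qed
  have "\<C> = {}" if "\<forall>C\<in>\<C>. simple_closed_curve_in X C" for \<C>
    using that no_curve by blast
  then have "genus X \<le> 0"
    unfolding genus_def by (intro Sup_least) (auto simp: zero_enat_def)
  with assms show False by simp
qed

text \<open>The numerator is the cutoff, with values between 0 and 1 and vanishing from radius R on.
  Using squared norms throughout keeps the function smooth at the centre.\<close>

definition bump :: "real^2 \<Rightarrow> real \<Rightarrow> real \<Rightarrow> real^2 \<Rightarrow> real" where
  "bump x0 R \<epsilon> x = flat 1 (R\<^sup>2 - (norm (x - x0))\<^sup>2) / ((norm (x - x0))\<^sup>2 + \<epsilon>\<^sup>2)"

lemma smooth_on_bump:
  assumes "\<epsilon> \<noteq> 0"
  shows "smooth_on (bump x0 R \<epsilon>) UNIV"
proof -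
  let ?q = "\<lambda>x. (x - x0) \<bullet> (x - x0)"
  have "smooth_on (\<lambda>x. x - x0) UNIV"
    using smooth_on_add[OF open_UNIV smooth_on_ident smooth_on_const, of "- x0"] by simp
  then have q: "smooth_on ?q UNIV"
    by (intro smooth_on_bilinear[OF open_UNIV bounded_bilinear_inner])
  have "smooth_on (\<lambda>x. ?q x + \<epsilon>\<^sup>2) UNIV"
    by (intro smooth_on_add open_UNIV q smooth_on_const)
  then have inv: "smooth_on (\<lambda>x. inverse (?q x + \<epsilon>\<^sup>2)) UNIV"
    by (rule smooth_on_compose[OF open_UNIV smooth_on_inverse]) (use assms in \<open>auto simp: add_nonneg_pos\<close>)
  have "smooth_on (\<lambda>x. R\<^sup>2 + (-1) * ?q x) UNIV"
    by (intro smooth_on_add open_UNIV q smooth_on_const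
        smooth_on_bilinear[OF open_UNIV bounded_bilinear_mult])
  then have "smooth_on (\<lambda>x. flat 1 (R\<^sup>2 + (-1) * ?q x)) UNIV"
    by (rule smooth_on_compose[OF open_UNIV smooth_on_flat]) simp
  from smooth_on_bilinear[OF open_UNIV bounded_bilinear_mult this inv]
  show ?thesis
    by (simp add: bump_def[abs_def] divide_inverse power2_norm_eq_inner)
qed

lemma bump_nonneg: "bump x0 R \<epsilon> x \<ge> 0"
  by (simp add: bump_def flat_def)

lemma bump_eq_0:
  assumes "R \<ge> 0" "x \<notin> ball x0 R"
  shows "bump x0 R \<epsilon> x = 0"
proof -
  have "R\<^sup>2 \<le> (norm (x - x0))\<^sup>2"
    using assms by (intro power_mono) (auto simp: dist_norm norm_minus_commute)
  then show ?thesis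
    by (simp add: bump_def flat_def)
qed

lemma bump_le: "bump x0 R \<epsilon> x \<le> 1 / ((norm (x - x0))\<^sup>2 + \<epsilon>\<^sup>2)"
  unfolding bump_def by (intro divide_right_mono) (auto simp: flat_def)

text \<open>On the half disc R^2 - r^2 is at least 3 R^2 / 4, so the cutoff is at least exp (-4 / (3
  R^2)), independently of \<epsilon>.\<close>

lemma bump_ge:
  assumes "R > 0" "x \<in> cball x0 (R / 2)"
  shows "bump x0 R \<epsilon> x \<ge> exp (- 4 / (3 * R\<^sup>2)) / ((norm (x - x0))\<^sup>2 + \<epsilon>\<^sup>2)"
proof -
  have "norm (x - x0) \<le> R / 2"
    using assms(2) by (simp add: dist_norm norm_minus_commute)
  then have "(norm (x - x0))\<^sup>2 \<le> (R / 2)\<^sup>2"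
    by (rule power_mono) simp
  then have le: "3 / 4 * R\<^sup>2 \<le> R\<^sup>2 - (norm (x - x0))\<^sup>2"
    by (simp add: power_divide)
  moreover have "0 < 3 / 4 * R\<^sup>2"
    using assms(1) by simp
  ultimately have pos: "0 < R\<^sup>2 - (norm (x - x0))\<^sup>2"
    by linarith
  have "1 / (R\<^sup>2 - (norm (x - x0))\<^sup>2) \<le> 1 / (3 / 4 * R\<^sup>2)"
    using le pos assms(1) by (intro divide_left_mono) auto
  then have "exp (- 4 / (3 * R\<^sup>2)) \<le> flat 1 (R\<^sup>2 - (norm (x - x0))\<^sup>2)"
    using pos by (simp add: flat_def)
  then show ?thesis
    unfolding bump_def by (rule divide_right_mono) simp
qed

text \<open>The quadratic form attains a positive minimum on the compact product of \<open>K\<close>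
  with the unit circle; homogeneity of degree two extends the bound to all vectors.\<close>

lemma metric_lower_bound_on_compact:
  assumes g: "riemannian_metric \<A> g" and c: "c \<in> \<A>" and K: "compact K" "K \<subseteq> ran_of c"
  obtains \<mu> where "\<mu> > 0" "\<And>x v. x \<in> K \<Longrightarrow> \<mu> * (v \<bullet> v) \<le> v \<bullet> (g c x *v v)"
proof (cases "K = {}")
  case True
  then show ?thesis using that[of 1] by simp
next
  case False
  let ?q = "\<lambda>(x, v). v \<bullet> (g c x *v v)"
  let ?S = "K \<times> sphere (0::real^2) 1"
  have "continuous_on K (g c)"
    using smooth_on_imp_continuous[OF metric_smooth[OF g c]] K(2) by (rule continuous_on_subset)
  then have "continuous_on ?S (\<lambda>z. g c (fst z))"
    by (rule continuous_on_compose2[OF _ continuous_on_fst[OF continuous_on_id]]) auto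
  then have "continuous_on ?S ?q"
    unfolding split_beta matrix_vector_mult_def by (intro continuous_intros)
  moreover have "compact ?S"
    by (intro compact_Times K(1) compact_sphere)
  moreover obtain e :: "real^2" where "norm e = 1"
    using vector_choose_size[of 1] by auto
  then have "?S \<noteq> {}"
    using False by auto
  ultimately have "\<exists>z\<in>?S. \<forall>w\<in>?S. ?q z \<le> ?q w"
    by (intro continuous_attains_inf)
  then obtain z where z: "z \<in> ?S" "\<forall>w\<in>?S. ?q z \<le> ?q w" ..
  show ?thesis
  proof (rule that)
    show "?q z > 0"
      using z(1) K(2) by (cases z) (auto intro!: metric_pos[OF g c])
    fix x v
    assume x: "x \<in> K"
    show "?q z * (v \<bullet> v) \<le> v \<bullet> (g c x *v v)"
    proof (cases "v = 0")
      case False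
      define e where "e = (1 / norm v) *\<^sub>R v"
      have v: "v = norm v *\<^sub>R e" and e: "norm e = 1"
        using False by (auto simp: e_def)
      have "?q z * (norm v)\<^sup>2 \<le> e \<bullet> (g c x *v e) * (norm v)\<^sup>2"
        using bspec[OF z(2), of "(x, e)"] x e by (intro mult_right_mono) auto
      also have "\<dots> = v \<bullet> (g c x *v v)"
      proof -
        have "(norm v *\<^sub>R e) \<bullet> (g c x *v (norm v *\<^sub>R e)) = e \<bullet> (g c x *v e) * (norm v)\<^sup>2"
          by (simp add: matrix_vector_mult_scaleR power2_eq_square)
        then show ?thesis
          unfolding v[symmetric] by simp
      qed
      finally show ?thesis by (simp add: power2_norm_eq_inner)
    qed simp
  qed
qed

lemma finite_chart_cover_first_nonempty:
  assumes "finite_chart_cover X \<A> cs" "topspace X \<noteq> {}"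
  obtains i where "i < length cs" "dom_of (cs ! i) \<noteq> {}" "\<And>j. j < i \<Longrightarrow> dom_of (cs ! j) = {}"
proof -
  have "\<exists>i. i < length cs \<and> dom_of (cs ! i) \<noteq> {}"
    using assms unfolding finite_chart_cover_def by (metis UN_E all_not_in_conv in_set_conv_nth)
  from exists_least_iff[THEN iffD1, OF this]
  show ?thesis using that by (meson less_trans)
qed

lemma riemannian_diam_ge:
  assumes "p \<in> topspace X" "q \<in> topspace X"
    and "\<And>\<gamma>. piecewise_C1_curve X \<A> \<gamma> \<Longrightarrow> \<gamma> 0 = p \<Longrightarrow> \<gamma> 1 = q \<Longrightarrow> L \<le> curve_length \<A> g \<gamma>"
  shows "L \<le> riemannian_diam X \<A> g"
proof -
  have "L \<le> riemannian_dist X \<A> g p q"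
    unfolding riemannian_dist_def by (intro Inf_greatest) (auto intro: assms(3))
  also have "\<dots> \<le> riemannian_diam X \<A> g"
    unfolding riemannian_diam_def by (intro SUP_upper2[OF assms(1)] SUP_upper2[OF assms(2)] order_refl)
  finally show ?thesis .
qed

lemma exists_large_ratio:
  fixes C D :: real
  assumes "C > 0"
  shows "\<exists>n::nat. sqrt (C / (n + 1)) / 2 * ln (1 + 4 ^ n / 4) > D"
proof -
  obtain n :: nat where n: "real n > max 3 ((8 * D)\<^sup>2 / C)"
    using reals_Archimedean2 by blast
  \<comment> \<open>The logarithm exceeds n - 1, hence (n + 1) / 4 for n > 3; with the factor 1 / 2
    the target exceeds sqrt (C (n + 1)) / 8.\<close>
  have "(8 * D)\<^sup>2 \<le> C * (n + 1)"
    using n assms by (simp add: field_simps)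
  then have "8 * \<bar>D\<bar> \<le> sqrt (C * (n + 1))"
    by (intro real_le_rsqrt) simp
  also have "\<dots> = sqrt (C / (n + 1)) * (n + 1)"
  proof -
    have "C * real (n + 1) = C / real (n + 1) * (real (n + 1))\<^sup>2"
      by (simp add: power2_eq_square del: of_nat_add of_nat_Suc)
    then show ?thesis
      by (simp only: real_sqrt_mult real_sqrt_abs abs_of_nat)
  qed
  also have "\<dots> < sqrt (C / (n + 1)) * (4 * ln (1 + 4 ^ n / 4))"
  proof (rule mult_strict_left_mono)
    have "ln (4::real) \<ge> 1"
      using exp_le by (subst ln_ge_iff) auto
    then have "1 * (real n - 1) \<le> ln 4 * (real n - 1)"
      using n by (intro mult_right_mono) auto
    also have "\<dots> = ln (4 ^ n / 4)"
      by (simp add: ln_div ln_realpow algebra_simps)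
    also have "\<dots> < ln (1 + 4 ^ n / 4)"
      by (rule ln_less_cancel_iff[THEN iffD2]) (auto intro: add_pos_pos)
    finally show "real (n + 1) < 4 * ln (1 + 4 ^ n / 4)"
      using n by simp
  qed (use assms in simp)
  finally have "D < sqrt (C / (n + 1)) / 2 * ln (1 + 4 ^ n / 4)"
    by (simp add: field_simps)
  then show ?thesis by blast
qed

section \<open>Choice of the parameters and the two estimates\<close>

lemma conformal_metric_large_diam:
  fixes X :: "'a topology" and \<A> :: "'a chart set" and \<sigma> :: "'a metric_field" and A D :: real
  assumes X: "compact_space X" "Hausdorff_space X" "topspace X \<noteq> {}" and atlas: "smooth_atlas X \<A>"
    and \<sigma>: "riemannian_metric \<A> \<sigma>" and A: "total_area X \<A> \<sigma> = ennreal A"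
  shows "\<exists>g. riemannian_metric \<A> g \<and> total_area X \<A> g = ennreal A \<and>
         conformally_equivalent \<A> g \<sigma> \<and> riemannian_diam X \<A> g > ennreal D"
proof -
  define cs where "cs = (SOME cs. finite_chart_cover X \<A> cs)"
  have cs: "finite_chart_cover X \<A> cs"
    unfolding cs_def by (rule someI_ex[OF finite_chart_cover_exists[OF X(1) atlas]])
  have cs_sub: "set cs \<subseteq> \<A>"
    using cs by (simp add: finite_chart_cover_def)
  have total: "total_area X \<A> g = area_via g cs" for g
    by (simp add: total_area_def cs_def)
  obtain i where i: "i < length cs" "dom_of (cs ! i) \<noteq> {}" "\<And>j. j < i \<Longrightarrow> dom_of (cs ! j) = {}"
    using finite_chart_cover_first_nonempty[OF cs X(3)] by blast
  define c where "c = cs ! i"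
  have c: "c \<in> \<A>"
    using cs_sub i(1) by (auto simp: c_def)
  note chart = atlas_chart[OF atlas c]
  obtain x0 where "x0 \<in> ran_of c"
    using i(2) by (auto simp: c_def ran_of_def)
  then obtain R where R: "R > 0" "cball x0 R \<subseteq> ran_of c"
    using chart_open[OF chart] open_contains_cball by blast
  have half: "cball x0 (R / 2) \<subseteq> ran_of c"
    using R by (intro order_trans[OF _ R(2)]) auto
  obtain \<mu> where \<mu>: "\<mu> > 0" "\<And>x v. x \<in> cball x0 R \<Longrightarrow> \<mu> * (v \<bullet> v) \<le> v \<bullet> (\<sigma> c x *v v)"
    using metric_lower_bound_on_compact[OF \<sigma> c compact_cball R(2)] by blast
  let ?\<rho> = "area_density \<sigma> c"
  have \<rho>_pos: "?\<rho> x > 0" if "x \<in> ran_of c" for x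
    using \<sigma> c that by (auto simp: riemannian_metric_def intro: pos_def_det_pos)
  have \<rho>_cont: "continuous_on (cball x0 R) ?\<rho>"
    using continuous_on_area_density[OF \<sigma> c] R(2) by (rule continuous_on_subset)
  have ne: "cball x0 R \<noteq> {}"
    using R(1) by simp
  obtain \<Lambda> where \<Lambda>: "\<Lambda> > 0" "\<And>x. x \<in> cball x0 R \<Longrightarrow> ?\<rho> x \<le> \<Lambda>"
    using continuous_attains_sup[OF compact_cball ne \<rho>_cont] \<rho>_pos R(2) by (meson subsetD)
  obtain \<nu> where \<nu>: "\<nu> > 0" "\<And>x. x \<in> cball x0 R \<Longrightarrow> \<nu> \<le> ?\<rho> x"
    using continuous_attains_inf[OF compact_cball ne \<rho>_cont] \<rho>_pos R(2) by (meson subsetD)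

  \<comment> \<open>\<open>ennreal\<close> sends every negative real to 0, so positivity must be
    extracted from the first nonempty piece. It is needed since \<open>b\<close> is proportional to
    A and \<open>k\<close> divides by A.\<close>
  have "A > 0"
  proof -
    have "0 < ennreal \<nu> * emeasure lborel (ball x0 R)"
      using \<nu>(1) R(1) by (simp add: ennreal_zero_less_mult_iff emeasure_ball unit_ball_vol_2)
    also have "\<dots> = (\<integral>\<^sup>+x\<in>ball x0 R. ennreal \<nu> \<partial>lborel)"
      by (simp add: nn_integral_cmult_indicator)
    also have "\<dots> \<le> (\<integral>\<^sup>+x\<in>coord c ` (dom_of c - (\<Union>j<i. dom_of (cs ! j))). ennreal (?\<rho> x) \<partial>lborel)"
    proof (rule nn_integral_mono)
      fix x
      have "coord c ` (dom_of c - (\<Union>j<i. dom_of (cs ! j))) = ran_of c"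
        using i(3) by (auto simp: ran_of_def)
      then show "ennreal \<nu> * indicator (ball x0 R) x \<le>
          ennreal (?\<rho> x) * indicator (coord c ` (dom_of c - (\<Union>j<i. dom_of (cs ! j)))) x"
        using \<nu>(2)[of x] R(2) ball_subset_cball[of x0 R]
        by (auto simp: indicator_def subset_iff intro: ennreal_leI)
    qed
    also have "\<dots> \<le> area_via \<sigma> cs"
      unfolding area_via_def c_def using i(1)
      by (intro member_le_sum[of i "{..<length cs}"
            "\<lambda>i. \<integral>\<^sup>+x\<in>coord (cs ! i) ` (dom_of (cs ! i) - (\<Union>j<i. dom_of (cs ! j))).
              ennreal (area_density \<sigma> (cs ! i) x) \<partial>lborel"]) auto
    finally show ?thesis
      using A by (simp add: total)
  qed

  define m where "m = exp (- 4 / (3 * R\<^sup>2))"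
  \<comment> \<open>The constant is chosen so that, divided by n + 1, it equals b m \<mu>, the
    square of the later \<open>\<kappa>\<close>.\<close>
  have "A * m * \<mu> / (8 * pi * \<Lambda>) > 0"
    using \<open>A > 0\<close> \<mu>(1) \<Lambda>(1) by (simp add: m_def)
  then obtain n :: nat
    where n: "D < sqrt (A * m * \<mu> / (8 * pi * \<Lambda>) / (n + 1)) / 2 * ln (1 + 4 ^ n / 4)"
    using exists_large_ratio by blast
  define \<epsilon> where "\<epsilon> = R / 2 ^ n"
  have \<epsilon>: "\<epsilon> > 0"
    using R(1) by (simp add: \<epsilon>_def)
  define \<psi> where "\<psi> = bump x0 R \<epsilon>"
  \<comment> \<open>The unscaled bump has area at most 4 \<pi> \<Lambda> (n + 1), so this amplitude
    makes the added area at most A / 2.\<close>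
  define b where "b = A / (8 * pi * \<Lambda> * (n + 1))"
  have b: "b > 0"
    using \<open>A > 0\<close> \<Lambda>(1) by (simp add: b_def)
  define I where "I = (\<integral>\<^sup>+x\<in>ran_of c. ennreal (\<psi> x * ?\<rho> x) \<partial>lborel)"
  have "I \<le> (\<integral>\<^sup>+x. ennreal \<Lambda> * (ennreal (1 / ((norm (x - x0))\<^sup>2 + \<epsilon>\<^sup>2)) * indicator (ball x0 R) x) \<partial>lborel)"
    unfolding I_def
  proof (rule nn_integral_mono)
    fix x
    show "ennreal (\<psi> x * ?\<rho> x) * indicator (ran_of c) x
      \<le> ennreal \<Lambda> * (ennreal (1 / ((norm (x - x0))\<^sup>2 + \<epsilon>\<^sup>2)) * indicator (ball x0 R) x)"
    proof (cases "x \<in> ball x0 R")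
      case True
      then have x: "x \<in> cball x0 R"
        using ball_subset_cball by blast
      then have "\<psi> x * ?\<rho> x \<le> 1 / ((norm (x - x0))\<^sup>2 + \<epsilon>\<^sup>2) * \<Lambda>"
        using \<Lambda>(2) \<rho>_pos[of x] R(2) by (intro mult_mono) (auto simp: \<psi>_def bump_le intro: less_imp_le)
      then show ?thesis
        using True subsetD[OF R(2) x] \<Lambda>(1)
        by (simp add: ennreal_mult'[symmetric] mult.commute ennreal_leI)
    next
      case False
      then show ?thesis
        using R(1) by (simp add: \<psi>_def bump_eq_0)
    qed
  qed
  also have "\<dots> = ennreal \<Lambda> * (\<integral>\<^sup>+x\<in>ball x0 R. ennreal (1 / ((norm (x - x0))\<^sup>2 + (R / 2 ^ n)\<^sup>2)) \<partial>lborel)"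
    unfolding \<epsilon>_def
    by (rule nn_integral_cmult, intro borel_measurable_times_ennreal borel_measurable_indicator) simp_all
  also have "\<dots> \<le> ennreal \<Lambda> * ennreal (4 * pi * (n + 1))"
    by (intro mult_left_mono nn_integral_annuli_le R(1)) simp
  also have "\<dots> = ennreal (4 * pi * \<Lambda> * (n + 1))"
    using \<Lambda>(1) by (simp add: ennreal_mult'[symmetric] mult_ac)
  finally have I_le: "I \<le> ennreal (4 * pi * \<Lambda> * (n + 1))" .
  then obtain J where J: "I = ennreal J" "J \<ge> 0"
    by (cases I) (auto simp: top_unique)
  have "J \<le> 4 * pi * \<Lambda> * (n + 1)"
    using I_le \<Lambda>(1) unfolding J(1) by (subst (asm) ennreal_le_iff) auto
  then have "b * J \<le> b * (4 * pi * \<Lambda> * (n + 1))"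
    using b by (intro mult_left_mono) auto
  also have "\<dots> = A / 2"
    using \<Lambda>(1) by (simp add: b_def field_simps del: of_nat_add of_nat_Suc)
  finally have bJ: "b * J \<le> A / 2" .

  \<comment> \<open>The solution of k A + b J = A; the bound on b J makes it at least 1 / 2.\<close>
  define k where "k = 1 - b * J / A"
  have k: "k > 0" "k * A + b * J = A"
    using bJ \<open>A > 0\<close> by (auto simp: k_def field_simps)
  define f where "f = (\<lambda>x. b * \<psi> x)"
  have f_nonneg: "f x \<ge> 0" for x
    using b by (simp add: f_def \<psi>_def bump_nonneg)
  have f_smooth: "smooth_on f UNIV"
    unfolding f_def \<psi>_def using \<epsilon>
    by (intro smooth_on_bilinear[OF open_UNIV bounded_bilinear_mult] smooth_on_const smooth_on_bump) auto
  define u where "u = extend_by c (\<lambda>x. 1 / 2 * ln (k + f x)) (1 / 2 * ln k)"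
  have exp_u: "exp (2 * u p) = extend_by c (\<lambda>x. k + f x) k p" for p
    using k(1) f_nonneg by (simp add: u_def extend_by_def add_pos_nonneg)
  have u: "smooth_function \<A> u"
    unfolding u_def
  proof (rule smooth_function_extend_by[OF atlas X(2) c compact_cball R(2)])
    have "smooth_on (\<lambda>x. ln (k + f x)) UNIV"
      using k(1) f_nonneg
      by (intro smooth_on_compose[OF open_UNIV smooth_on_ln] smooth_on_add smooth_on_const f_smooth)
        (auto simp: add_pos_nonneg)
    from smooth_on_bilinear[OF open_UNIV bounded_bilinear_mult smooth_on_const[OF open_UNIV] this]
    show "smooth_on (\<lambda>x. 1 / 2 * ln (k + f x)) (ran_of c)"
      by (rule smooth_on_subset) simp
    show "1 / 2 * ln (k + f x) = 1 / 2 * ln k" if "x \<in> ran_of c - cball x0 R" for x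
      using that R(1) ball_subset_cball[of x0 R] bump_eq_0[of R x x0 \<epsilon>] by (auto simp: f_def \<psi>_def)
  qed
  define g where "g = conformal_metric u \<sigma>"
  have g: "riemannian_metric \<A> g"
    unfolding g_def by (rule riemannian_metric_conformal_metric[OF atlas \<sigma> u])

  have "total_area X \<A> g = ennreal k * ennreal A
      + (\<integral>\<^sup>+x\<in>ran_of c. ennreal (f x * ?\<rho> x) \<partial>lborel)"
    unfolding total g_def A[unfolded total, symmetric] c_def
    using area_via_conformal_bump[OF atlas cs_sub \<sigma> i(1,3), of f k u]
      smooth_on_imp_continuous[OF f_smooth] f_nonneg k(1) exp_u
    by (auto simp: c_def intro: continuous_on_subset)
  also have "(\<integral>\<^sup>+x\<in>ran_of c. ennreal (f x * ?\<rho> x) \<partial>lborel) = ennreal b * I"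
  proof -
    have "continuous_on UNIV \<psi>"
      unfolding \<psi>_def using \<epsilon> by (intro smooth_on_imp_continuous smooth_on_bump) simp
    then have "continuous_on (ran_of c) \<psi>"
      by (rule continuous_on_subset) simp
    then have "continuous_on (ran_of c) (\<lambda>x. \<psi> x * ?\<rho> x)"
      by (intro continuous_on_mult continuous_on_area_density[OF \<sigma> c])
    then have "(\<lambda>x. ennreal (\<psi> x * ?\<rho> x) * indicator (ran_of c) x) \<in> borel_measurable borel"
      by (rule borel_measurable_ennreal_indicator[OF chart_open[OF chart]])
        (use chart_open[OF chart] in auto)
    then show ?thesis
      unfolding I_def using b
      by (subst nn_integral_cmult[symmetric]) (auto simp: f_def ennreal_mult' mult.assoc)
  qed
  also have "ennreal k * ennreal A + ennreal b * I = ennreal A"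
    using k b J \<open>A > 0\<close> by (simp add: ennreal_mult'[symmetric] ennreal_plus[symmetric] del: ennreal_plus)
  finally have area: "total_area X \<A> g = ennreal A" .

  \<comment> \<open>The product collects the amplitude, the lower bound of the cutoff on the half
    disc, and the comparison of \<sigma> with the Euclidean metric.\<close>
  define \<kappa> where "\<kappa> = sqrt (b * m * \<mu>)"
  have \<kappa>: "\<kappa> \<ge> 0" "\<kappa>\<^sup>2 = b * m * \<mu>"
    using b \<mu>(1) by (auto simp: \<kappa>_def m_def)
  have bound: "\<kappa>\<^sup>2 * (v \<bullet> v) / ((norm (x - x0))\<^sup>2 + \<epsilon>\<^sup>2) \<le> v \<bullet> (g c x *v v)"
    if x: "x \<in> cball x0 (R / 2)" for x v
  proof -
    have xR: "x \<in> cball x0 R"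
      using x R(1) by auto
    have "\<kappa>\<^sup>2 * (v \<bullet> v) / ((norm (x - x0))\<^sup>2 + \<epsilon>\<^sup>2) = b * (m / ((norm (x - x0))\<^sup>2 + \<epsilon>\<^sup>2)) * (\<mu> * (v \<bullet> v))"
      by (simp add: \<kappa>(2))
    also have "\<dots> \<le> (k + f x) * (\<mu> * (v \<bullet> v))"
    proof (rule mult_right_mono)
      have "b * (m / ((norm (x - x0))\<^sup>2 + \<epsilon>\<^sup>2)) \<le> f x"
        unfolding f_def \<psi>_def m_def using b bump_ge[OF R(1) x] by (intro mult_left_mono) auto
      then show "b * (m / ((norm (x - x0))\<^sup>2 + \<epsilon>\<^sup>2)) \<le> k + f x"
        using k(1) by simp
    qed (use \<mu>(1) in simp)
    also have "\<dots> \<le> (k + f x) * (v \<bullet> (\<sigma> c x *v v))"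
      using k(1) f_nonneg by (intro mult_left_mono \<mu>(2) xR) (simp add: add_nonneg_nonneg)
    also have "\<dots> = v \<bullet> (g c x *v v)"
    proof -
      have "x \<in> ran_of c"
        using xR R(2) by blast
      then show ?thesis
        by (simp add: g_def conformal_metric_def exp_u extend_by_def inv_coord_in_dom coord_inv_coord
            scaleR_matrix_vector_assoc[symmetric])
    qed
    finally show ?thesis .
  qed
  \<comment> \<open>Any point of the bounding circle will do: a curve from the centre to it must
    leave the open half disc.\<close>
  obtain z where "norm (z - x0) = R / 2"
    using vector_choose_dist[of "R / 2" x0] R(1) by (auto simp: dist_norm norm_minus_commute)
  then have z: "z \<in> cball x0 (R / 2)" "z \<notin> ball x0 (R / 2)"
    by (auto simp: dist_norm norm_minus_commute)
  have not_in: "inv_coord c z \<notin> inv_coord c ` ball x0 (R / 2)"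
  proof
    assume "inv_coord c z \<in> inv_coord c ` ball x0 (R / 2)"
    then obtain w where w: "w \<in> ball x0 (R / 2)" "inv_coord c z = inv_coord c w" ..
    then have "coord c (inv_coord c w) = w"
      using half by (intro coord_inv_coord) (auto simp: subset_iff)
    moreover have "coord c (inv_coord c z) = z"
      using half z(1) by (intro coord_inv_coord) blast
    ultimately have "z = w"
      using w(2) by simp
    with w(1) z(2) show False by simp
  qed
  have "ennreal (\<kappa> / 2 * ln (((R / 2)\<^sup>2 + \<epsilon>\<^sup>2) / \<epsilon>\<^sup>2)) \<le> riemannian_diam X \<A> g"
  proof (rule riemannian_diam_ge)
    show "inv_coord c x0 \<in> topspace X" "inv_coord c z \<in> topspace X"
      using z(1) half R(1) chart_dom_subset[OF chart] by (auto simp: subset_iff inv_coord_in_dom)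
    fix \<gamma>
    assume "piecewise_C1_curve X \<A> \<gamma>" "\<gamma> 0 = inv_coord c x0" "\<gamma> 1 = inv_coord c z"
    then show "ennreal (\<kappa> / 2 * ln (((R / 2)\<^sup>2 + \<epsilon>\<^sup>2) / \<epsilon>\<^sup>2)) \<le> curve_length \<A> g \<gamma>"
      using R(1) \<epsilon> not_in by (intro curve_length_ge[OF atlas X(2) g c half _ \<kappa>(1) _ bound]) auto
  qed
  moreover have "((R / 2)\<^sup>2 + \<epsilon>\<^sup>2) / \<epsilon>\<^sup>2 = 1 + 4 ^ n / 4"
    using R(1) by (simp add: \<epsilon>_def field_simps power2_eq_square flip: power_mult_distrib)
  moreover have "\<kappa> = sqrt (A * m * \<mu> / (8 * pi * \<Lambda>) / (n + 1))"
    by (simp add: \<kappa>_def b_def field_simps)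
  \<comment> \<open>Strict inequality survives \<open>ennreal\<close> only when the larger side is
    positive.\<close>
  moreover have "\<kappa> / 2 * ln (1 + 4 ^ n / 4) > 0"
    using b \<mu>(1) by (intro mult_pos_pos ln_gt_zero) (auto simp: \<kappa>_def m_def)
  ultimately have "ennreal D < riemannian_diam X \<A> g"
    using n by (metis ennreal_lessI order_less_le_trans)
  moreover have "conformally_equivalent \<A> g \<sigma>"
    unfolding g_def by (rule conformally_equivalent_conformal_metric[OF u])
  ultimately show ?thesis
    using g area by blast
qed

theorem lemma4p3:
  fixes X :: "'a topology" and \<A> :: "'a chart set" and \<sigma> :: "'a metric_field" and A :: real
  assumes "closed_smooth_surface X \<A>"
    and "genus X \<ge> 2"
    and "hyperbolic_metric \<A> \<sigma>"
    and "total_area X \<A> \<sigma> = ennreal A"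
  shows "\<forall>D::real. D > 0 \<longrightarrow>
    (\<exists>g. riemannian_metric \<A> g \<and> total_area X \<A> g = ennreal A \<and>
         conformally_equivalent \<A> g \<sigma> \<and> riemannian_diam X \<A> g > ennreal D)"
proof (intro allI impI conformal_metric_large_diam)
  have "0 < (2 :: enat)" by simp
  also note assms(2)
  finally show "topspace X \<noteq> {}" by (rule genus_pos_imp_nonempty)
qed (use assms in \<open>auto simp: closed_smooth_surface_def hyperbolic_metric_def\<close>)

end
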